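(* Let $\Omega\subset\mathbb{R}^2$. There is a constant $C_{stab}>0$, independent of $h$, $\Delta t_n$, $\omega_n$, $\nu$ and of the discrete solution, such that if $N>1$, $u_h^0,u_h^1\in X_h$, $(u_h^{n+1},p^{n+1})$ are given by the VSS BE-AB2 scheme for $n=1,\dots,N-1$, and for every $n=1,\dots,N-1$ $$1-\frac{C_{stab}\,\Delta t_n(1+\omega_n^2)\,|\ln h|}{\nu}\,\|\nabla E^{n+1}(u_h)\|^2\geq 0,$$ then $$\frac12\|u_h^N\|^2+\frac14\|u_h^N-u_h^{N-1}\|^2+\frac{\nu}{4}\sum_{n=1}^{N-1}\Delta t_n\|\nabla u_h^{n+1}\|^2+\sum_{n=1}^{N-1}\frac{1}{8(1+\omega_n^2)}\big\|u_h^{n+1}-u_h^n+\omega_n(u_h^n-u_h^{n-1})\big\|^2$$ $$\leq\sum_{n=1}^{N-1}\frac{\Delta t_n}{\nu}\|f^{n+1}\|_{-1}^2+\frac12\|u_h^1\|^2+\frac14\|u_h^1-u_h^0\|^2 .$$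
   Context: $\Omega\subset\mathbb{R}^2$ is a bounded regular polygonal domain; $\|\cdot\|,(\cdot,\cdot)$ are the $L^2(\Omega)$ norm and inner product. $X=[H^1_0(\Omega)]^2$, $Q=L^2_0(\Omega)$. $X_h\subset X$, $Q_h\subset Q$ are conforming finite element spaces on a regular (quasi-uniform) triangulation of maximal diameter $h$, satisfying the discrete inf-sup condition and the inverse inequalities $\|v_h\|\le Ch^{-1}\|\nabla v_h\|$ and $\|v_h\|_{L^\infty}\le C|\ln h|^{1/2}\|\nabla v_h\|$ for all $v_h\in X_h$. $\|f\|_{-1}=\sup_{0\ne v\in X}(f,v)/\|\nabla v\|$. $b^{\ast}(u,v,w)=\tfrac12(u\cdot\nabla v,w)-\tfrac12(u\cdot\nabla w,v)$. $\nu>0$. Time grid $0=t^0<\dots<t^N$, $\Delta t_n=t^{n+1}-t^n$, $\omega_n=\Delta t_n/\Delta t_{n-1}$, $E^{n+1}(v)=(1+\omega_n)v^n-\omega_n v^{n-1}$. The VSS BE-AB2 scheme: for $n=1,\dots,N-1$ find $(u_h^{n+1},p^{n+1})\in X_h\times Q_h$ with $\big(\tfrac{u_h^{n+1}-u_h^n}{\Delta t_n},v_h\big)+\nu(\nabla u_h^{n+1},\nabla v_h)+b^{\ast}(E^{n+1}(u_h),E^{n+1}(u_h),v_h)-(p^{n+1},\nabla\cdot v_h)=(f^{n+1},v_h)$ for all $v_h\in X_h$, and $(\nabla\cdot u_h^{n+1},q_h)=0$ for all $q_h\in Q_h$. *)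

theory Defs
  imports "HOL-Analysis.Analysis"
begin

text \<open>Points of the plane, velocity fields, scalar fields and matrix fields.
  The convention for gradients is (grad v x) $ i $ j = partial_j v_i (Jacobian),
  so that (u . nabla) v = grad v *v u.\<close>

type_synonym pt = "real^2"

definition polygonal_domain :: "pt set \<Rightarrow> bool" where
  "polygonal_domain \<Omega> \<longleftrightarrow> open \<Omega> \<and> connected \<Omega> \<and> bounded \<Omega> \<and> \<Omega> \<noteq> {} \<and>
     interior (closure \<Omega>) = \<Omega> \<and>
     (\<exists>S. finite S \<and> frontier \<Omega> = (\<Union>(a,b)\<in>S. closed_segment a b))"

definition L2fun :: "pt set \<Rightarrow> (pt \<Rightarrow> 'a::euclidean_space) \<Rightarrow> bool" where
  "L2fun \<Omega> u \<longleftrightarrow> u \<in> borel_measurable (lebesgue_on \<Omega>) \<and>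
     integrable (lebesgue_on \<Omega>) (\<lambda>x. (norm (u x))^2)"

definition L2ip :: "pt set \<Rightarrow> (pt \<Rightarrow> 'a::euclidean_space) \<Rightarrow> (pt \<Rightarrow> 'a) \<Rightarrow> real" where
  "L2ip \<Omega> u v = (LINT x|lebesgue_on \<Omega>. u x \<bullet> v x)"

definition L2norm :: "pt set \<Rightarrow> (pt \<Rightarrow> 'a::euclidean_space) \<Rightarrow> real" where
  "L2norm \<Omega> u = sqrt (L2ip \<Omega> u u)"

definition Cc1 :: "pt set \<Rightarrow> (pt \<Rightarrow> real^2) \<Rightarrow> (pt \<Rightarrow> real^2^2) \<Rightarrow> bool" where
  "Cc1 \<Omega> \<phi> D\<phi> \<longleftrightarrow> (\<forall>x. (\<phi> has_derivative (\<lambda>k. D\<phi> x *v k)) (at x)) \<and>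
     continuous_on UNIV D\<phi> \<and>
     (\<exists>K. compact K \<and> K \<subseteq> \<Omega> \<and> (\<forall>x. x \<notin> K \<longrightarrow> \<phi> x = 0))"

definition H10_grad :: "pt set \<Rightarrow> (pt \<Rightarrow> real^2) \<Rightarrow> (pt \<Rightarrow> real^2^2) \<Rightarrow> bool" where
  "H10_grad \<Omega> v G \<longleftrightarrow> L2fun \<Omega> v \<and> L2fun \<Omega> G \<and>
     (\<exists>\<phi> D\<phi>. (\<forall>k::nat. Cc1 \<Omega> (\<phi> k) (D\<phi> k)) \<and>
        (\<lambda>k. L2norm \<Omega> (\<lambda>x. \<phi> k x - v x)) \<longlonglongrightarrow> 0 \<and>
        (\<lambda>k. L2norm \<Omega> (\<lambda>x. D\<phi> k x - G x)) \<longlonglongrightarrow> 0)"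

definition H10 :: "pt set \<Rightarrow> (pt \<Rightarrow> real^2) set" where
  "H10 \<Omega> = {v. \<exists>G. H10_grad \<Omega> v G}"

definition grad :: "pt set \<Rightarrow> (pt \<Rightarrow> real^2) \<Rightarrow> (pt \<Rightarrow> real^2^2)" where
  "grad \<Omega> v = (SOME G. H10_grad \<Omega> v G)"

definition divg :: "pt set \<Rightarrow> (pt \<Rightarrow> real^2) \<Rightarrow> (pt \<Rightarrow> real)" where
  "divg \<Omega> v = (\<lambda>x. \<Sum>i\<in>UNIV. grad \<Omega> v x $ i $ i)"

definition gradnorm :: "pt set \<Rightarrow> (pt \<Rightarrow> real^2) \<Rightarrow> real" where
  "gradnorm \<Omega> v = L2norm \<Omega> (grad \<Omega> v)"

definition L20 :: "pt set \<Rightarrow> (pt \<Rightarrow> real) set" where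
  "L20 \<Omega> = {q. L2fun \<Omega> q \<and> (LINT x|lebesgue_on \<Omega>. q x) = 0}"

definition dualnorm :: "pt set \<Rightarrow> (pt \<Rightarrow> real^2) \<Rightarrow> real" where
  "dualnorm \<Omega> f = Sup {L2ip \<Omega> f v / gradnorm \<Omega> v | v. v \<in> H10 \<Omega> \<and> gradnorm \<Omega> v \<noteq> 0}"

definition bstar :: "pt set \<Rightarrow> (pt \<Rightarrow> real^2) \<Rightarrow> (pt \<Rightarrow> real^2) \<Rightarrow> (pt \<Rightarrow> real^2) \<Rightarrow> real" where
  "bstar \<Omega> u v w = 1/2 * L2ip \<Omega> (\<lambda>x. grad \<Omega> v x *v u x) w
                   - 1/2 * L2ip \<Omega> (\<lambda>x. grad \<Omega> w x *v u x) v"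

definition lin_subspace :: "(pt \<Rightarrow> 'a::real_vector) set \<Rightarrow> bool" where
  "lin_subspace S \<longleftrightarrow> (\<lambda>x. 0) \<in> S \<and> (\<forall>u\<in>S. \<forall>v\<in>S. (\<lambda>x. u x + v x) \<in> S) \<and>
     (\<forall>c. \<forall>u\<in>S. (\<lambda>x. c *\<^sub>R u x) \<in> S)"

definition fin_dim :: "(pt \<Rightarrow> 'a::real_vector) set \<Rightarrow> bool" where
  "fin_dim S \<longleftrightarrow> (\<exists>B. finite B \<and> B \<subseteq> S \<and> (\<forall>v\<in>S. \<exists>c. v = (\<lambda>x. \<Sum>b\<in>B. c b *\<^sub>R b x)))"

definition fe_spaces :: "pt set \<Rightarrow> real \<Rightarrow> real \<Rightarrow> (pt \<Rightarrow> real^2) set \<Rightarrow> (pt \<Rightarrow> real) set \<Rightarrow> bool" where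
  "fe_spaces \<Omega> Cinv h Xh Qh \<longleftrightarrow>
     Xh \<subseteq> H10 \<Omega> \<and> lin_subspace Xh \<and> fin_dim Xh \<and>
     Qh \<subseteq> L20 \<Omega> \<and> lin_subspace Qh \<and> fin_dim Qh \<and>
     (\<exists>\<beta>>0. \<forall>q\<in>Qh. L2norm \<Omega> q \<noteq> 0 \<longrightarrow>
        \<beta> * L2norm \<Omega> q \<le> Sup {L2ip \<Omega> q (divg \<Omega> v) / gradnorm \<Omega> v | v. v \<in> Xh \<and> gradnorm \<Omega> v \<noteq> 0}) \<and>
     (\<forall>v\<in>Xh. L2norm \<Omega> v \<le> Cinv / h * gradnorm \<Omega> v \<and>
        (AE x in lebesgue_on \<Omega>. norm (v x) \<le> Cinv * sqrt \<bar>ln h\<bar> * gradnorm \<Omega> v))"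

definition dt :: "(nat \<Rightarrow> real) \<Rightarrow> nat \<Rightarrow> real" where
  "dt t n = t (Suc n) - t n"

definition omega :: "(nat \<Rightarrow> real) \<Rightarrow> nat \<Rightarrow> real" where
  "omega t n = dt t n / dt t (n - 1)"

text \<open>Eext t u n is E^{n+1}(u) = (1+omega_n) u^n - omega_n u^{n-1}.\<close>
definition Eext :: "(nat \<Rightarrow> real) \<Rightarrow> (nat \<Rightarrow> pt \<Rightarrow> real^2) \<Rightarrow> nat \<Rightarrow> pt \<Rightarrow> real^2" where
  "Eext t u n = (\<lambda>x. (1 + omega t n) *\<^sub>R u n x - omega t n *\<^sub>R u (n - 1) x)"

definition VSS_BE_AB2 ::
  "pt set \<Rightarrow> (pt \<Rightarrow> real^2) set \<Rightarrow> (pt \<Rightarrow> real) set \<Rightarrow> real \<Rightarrow> (nat \<Rightarrow> real) \<Rightarrow> nat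
   \<Rightarrow> (nat \<Rightarrow> pt \<Rightarrow> real^2) \<Rightarrow> (nat \<Rightarrow> pt \<Rightarrow> real^2) \<Rightarrow> (nat \<Rightarrow> pt \<Rightarrow> real) \<Rightarrow> bool" where
  "VSS_BE_AB2 \<Omega> Xh Qh \<nu> t N f u p \<longleftrightarrow>
     (\<forall>n\<le>N. u n \<in> Xh) \<and> (\<forall>n\<in>{2..N}. p n \<in> Qh) \<and>
     (\<forall>n\<in>{1..N-1}.
        (\<forall>v\<in>Xh.
           L2ip \<Omega> (\<lambda>x. (1 / dt t n) *\<^sub>R (u (n+1) x - u n x)) v
           + \<nu> * L2ip \<Omega> (grad \<Omega> (u (n+1))) (grad \<Omega> v)
           + bstar \<Omega> (Eext t u n) (Eext t u n) v
           - L2ip \<Omega> (p (n+1)) (divg \<Omega> v)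
           = L2ip \<Omega> (f (n+1)) v) \<and>
        (\<forall>q\<in>Qh. L2ip \<Omega> (divg \<Omega> (u (n+1))) q = 0))"

end

theory Submission
  imports Defs
begin

text \<open>Test the scheme with $u^{n+1}$. Write $E = E^{n+1}(u_h)$ and $w = u^{n+1} - E = a - \omega_n b$ with
  $a = u^{n+1} - u^n$, $b = u^n - u^{n-1}$. As $b^*(E, \cdot, \cdot)$ is skew-symmetric,
  $b^*(E, E, u^{n+1}) = b^*(E, u^{n+1}, w) = (E \cdot \nabla u^{n+1}, w) + \frac12 ((\nabla \cdot E) u^{n+1}, w)$,
  which the $L^\infty$ inverse inequality bounds by
  $2 C |\ln h|^{1/2} \|\nabla E\| \|\nabla u^{n+1}\| \|w\|$. Young's inequality and the step-size condition
  absorb it into the viscous term and into $\frac18 (\|a\|^2 + \|b\|^2) \geq \|w\|^2 / (8 (1 + \omega_n^2))$,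
  where $\frac14 (\|a\|^2 + \|b\|^2)$ is what remains of the numerical dissipation $\frac12 \|a\|^2$ after
  splitting off the telescoping $\frac14 (\|a\|^2 - \|b\|^2)$.

  Uniqueness of the weak gradient is not needed: \<^term>\<open>w\<close> is paired with the difference of the
  chosen gradients of $u^{n+1}$ and $E$, never with its own.\<close>

section \<open>Integrals of directional derivatives\<close>

text \<open>By translation invariance the difference quotients of \<^term>\<open>F\<close> have integral zero, and
  they converge dominatedly.\<close>

lemma has_bochner_integral_directional_derivative:
  fixes F :: "'a::euclidean_space \<Rightarrow> real"
  assumes der: "\<And>x. (F has_derivative F' x) (at x)"
    and cont: "continuous_on UNIV (\<lambda>x. F' x e)"
    and K: "compact K" "\<And>x. x \<notin> K \<Longrightarrow> F x = 0"
    and \<Omega>: "open \<Omega>" "K \<subseteq> \<Omega>"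
  shows "has_bochner_integral (lebesgue_on \<Omega>) (\<lambda>x. F' x e) 0"
proof -
  define g where "g = (\<lambda>x. F' x e)"
  define s where "s = (\<lambda>n. inverse (real (Suc n)))"
  define q where "q = (\<lambda>n x. (F (x + s n *\<^sub>R e) - F x) / s n)"
  have s0: "0 < s n" "s n \<le> 1" for n
    by (auto simp: s_def divide_simps)
  have contF: "continuous_on UNIV F"
    using der has_derivative_continuous by (force simp: continuous_on_eq_continuous_at)
  have g0: "g x = 0" if "x \<notin> K" for x
  proof -
    have "(F has_derivative (\<lambda>_. 0)) (at x)"
      by (rule has_derivative_transform_within_open[of "\<lambda>_. 0" _ x UNIV "- K"])
        (use that K compact_imp_closed in auto)
    then have "F' x = (\<lambda>_. 0)"
      using der has_derivative_unique by blast
    then show ?thesis by (simp add: g_def)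
  qed
  obtain M where M: "\<And>x. \<bar>g x\<bar> \<le> M"
  proof -
    have "compact (g ` K)"
      using K(1) cont unfolding g_def
      by (intro compact_continuous_image) (auto intro: continuous_on_subset)
    then obtain B where "\<And>x. x \<in> K \<Longrightarrow> \<bar>g x\<bar> \<le> B"
      using compact_imp_bounded bounded_iff by (metis imageI real_norm_def)
    then have "\<bar>g x\<bar> \<le> max B 0" for x
      using g0[of x] by (cases "x \<in> K") (auto simp: max.coboundedI1)
    then show ?thesis using that by blast
  qed
  obtain R where R: "\<And>x. x \<in> K \<Longrightarrow> norm x \<le> R"
    using K(1) compact_imp_bounded bounded_iff by metis
  define S where "S = cball (0::'a) (R + norm e)"
  have line: "((\<lambda>\<tau>. F (x + \<tau> *\<^sub>R e)) has_real_derivative g (x + \<tau> *\<^sub>R e)) (at \<tau>)" for x \<tau>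
  proof -
    have "((\<lambda>\<tau>. F (x + \<tau> *\<^sub>R e)) has_derivative (\<lambda>k. F' (x + \<tau> *\<^sub>R e) (k *\<^sub>R e))) (at \<tau>)"
      by (rule has_derivative_compose[OF _ der]) (auto intro!: derivative_eq_intros)
    moreover have "F' y (k *\<^sub>R e) = g y * k" for y k
      using linear_cmul[OF has_derivative_linear[OF der]] by (simp add: g_def mult.commute)
    ultimately show ?thesis by (simp add: has_field_derivative_def)
  qed
  have qM: "\<bar>q n x\<bar> \<le> M" for n x
  proof -
    obtain z where "F (x + s n *\<^sub>R e) - F (x + 0 *\<^sub>R e) = (s n - 0) * g (x + z *\<^sub>R e)"
      using MVT2[OF s0(1), of n "\<lambda>\<tau>. F (x + \<tau> *\<^sub>R e)" "\<lambda>\<tau>. g (x + \<tau> *\<^sub>R e)"] line by blast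
    then have "q n x = g (x + z *\<^sub>R e)"
      using s0(1)[of n] by (simp add: q_def)
    then show ?thesis using M by simp
  qed
  have bound: "norm (q n x) \<le> indicator S x *\<^sub>R M" for n x
  proof (cases "x \<in> S")
    case False
    have "s n * norm e \<le> norm e"
      using s0[of n] by (simp add: mult_left_le_one_le)
    moreover have "norm x \<le> R \<Longrightarrow> norm x \<le> R + norm e"
      by (simp add: add_increasing2)
    ultimately have "x \<notin> K" "x + s n *\<^sub>R e \<notin> K"
      using False R[of x] R[of "x + s n *\<^sub>R e"] norm_triangle_ineq4[of "x + s n *\<^sub>R e" "s n *\<^sub>R e"] s0[of n]
      by (auto simp: S_def)
    then show ?thesis using K(2) False by (simp add: q_def)
  qed (use qM in auto)
  have qlim: "(\<lambda>n. q n x) \<longlonglongrightarrow> g x" for x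
  proof -
    have "filterlim s (at 0) sequentially"
      using LIMSEQ_inverse_real_of_nat s0
      by (auto simp: filterlim_at s_def order_less_imp_not_eq2)
    moreover have "((\<lambda>h. (F (x + h *\<^sub>R e) - F x) / h) \<longlongrightarrow> g x) (at 0)"
      using line[of x 0] by (simp add: DERIV_def)
    ultimately show ?thesis
      unfolding q_def using filterlim_compose by blast
  qed
  have [measurable]: "F \<in> borel_measurable borel"
    using contF by (rule borel_measurable_continuous_onI)
  have cint: "integrable lborel f" if "continuous_on UNIV f" "\<And>x. x \<notin> K \<Longrightarrow> f x = 0" for f :: "'a \<Rightarrow> real"
  proof -
    have "integrable lborel (\<lambda>x. indicator K x *\<^sub>R f x)"
      using K(1) that(1) continuous_on_subset by (intro borel_integrable_compact) auto
    moreover have "(\<lambda>x. indicator K x *\<^sub>R f x) = f"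
      using that(2) by (force simp: indicator_def)
    ultimately show ?thesis by simp
  qed
  note Fint = cint[OF contF K(2)]
  have shift: "integrable lborel (\<lambda>x. F (x + c))" "(LINT x|lborel. F (x + c)) = (LINT x|lborel. F x)" for c
  proof -
    have "integrable (distr lborel borel ((+) c)) F"
      using Fint lborel_distr_plus[of c] by simp
    then show "integrable lborel (\<lambda>x. F (x + c))"
      by (subst (asm) integrable_distr_eq) (auto simp: add.commute)
    have "(LINT x|lborel. F x) = (LINT x|distr lborel borel ((+) c). F x)"
      using lborel_distr_plus[of c] by simp
    also have "\<dots> = (LINT x|lborel. F (x + c))"
      by (subst integral_distr) (auto simp: add.commute)
    finally show "(LINT x|lborel. F (x + c)) = (LINT x|lborel. F x)" by simp
  qed
  have "(\<lambda>n. LINT x|lborel. q n x) \<longlonglongrightarrow> (LINT x|lborel. g x)"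
  proof (rule integral_dominated_convergence[where w = "\<lambda>x. indicator S x *\<^sub>R M"])
    show "g \<in> borel_measurable lborel"
      using cont by (simp add: g_def borel_measurable_continuous_onI)
    show "q n \<in> borel_measurable lborel" for n
      unfolding q_def by measurable
    show "integrable lborel (\<lambda>x. indicator S x *\<^sub>R M)"
      by (rule borel_integrable_compact) (auto simp: S_def)
  qed (use qlim bound in auto)
  moreover have "(LINT x|lborel. q n x) = 0" for n
    using shift Fint by (simp add: q_def)
  ultimately have int0: "(LINT x|lborel. g x) = 0"
    by (simp add: LIMSEQ_const_iff)
  have contg: "continuous_on UNIV g"
    using cont by (simp add: g_def)
  have "has_bochner_integral lborel g 0"
    using cint[OF contg g0] int0 by (simp add: has_bochner_integral_iff)
  moreover have "g \<in> borel_measurable lborel"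
    using contg by (simp add: borel_measurable_continuous_onI)
  moreover have "(\<lambda>x. indicator \<Omega> x *\<^sub>R g x) = g"
    using g0 \<Omega>(2) by (force simp: indicator_def)
  ultimately show ?thesis
    using \<Omega>(1)
    by (simp add: has_bochner_integral_iff integrable_restrict_space integral_restrict_space
        integrable_completion integral_completion flip: g_def)
qed

section \<open>Square-integrable fields\<close>

lemma L2ip_nonneg: "0 \<le> L2ip \<Omega> u u"
  by (simp add: L2ip_def)

lemma L2norm_nonneg: "0 \<le> L2norm \<Omega> u"
  by (simp add: L2norm_def L2ip_nonneg)

lemma L2norm_power2: "(L2norm \<Omega> u)\<^sup>2 = L2ip \<Omega> u u"
  by (simp add: L2norm_def L2ip_nonneg)

lemma L2ip_commute: "L2ip \<Omega> u v = L2ip \<Omega> v u"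
  by (simp add: L2ip_def inner_commute)

lemma L2fun_measurable [measurable_dest]: "L2fun \<Omega> u \<Longrightarrow> u \<in> borel_measurable (lebesgue_on \<Omega>)"
  by (simp add: L2fun_def)

lemma L2fun_bound:
  assumes A: "L2fun \<Omega> A" and B: "B \<in> borel_measurable (lebesgue_on \<Omega>)"
    and le: "AE x in lebesgue_on \<Omega>. norm (B x) \<le> K * norm (A x)" and K: "0 \<le> K"
  shows "L2fun \<Omega> B" and "L2norm \<Omega> B \<le> K * L2norm \<Omega> A"
proof -
  have int: "integrable (lebesgue_on \<Omega>) (\<lambda>x. K\<^sup>2 * (norm (A x))\<^sup>2)"
    using A by (simp add: L2fun_def)
  have le2: "AE x in lebesgue_on \<Omega>. (norm (B x))\<^sup>2 \<le> K\<^sup>2 * (norm (A x))\<^sup>2"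
    using le
  proof (rule AE_mp, intro AE_I2 impI)
    fix x assume "norm (B x) \<le> K * norm (A x)"
    then have "(norm (B x))\<^sup>2 \<le> (K * norm (A x))\<^sup>2"
      by (intro power_mono) auto
    then show "(norm (B x))\<^sup>2 \<le> K\<^sup>2 * (norm (A x))\<^sup>2"
      by (simp add: power_mult_distrib)
  qed
  show L: "L2fun \<Omega> B"
    unfolding L2fun_def using B le2
    by (auto intro!: Bochner_Integration.integrable_bound[OF int] elim!: AE_mp)
  have "L2ip \<Omega> B B \<le> (LINT x|lebesgue_on \<Omega>. K\<^sup>2 * (norm (A x))\<^sup>2)"
    unfolding L2ip_def power2_norm_eq_inner[symmetric]
    by (rule integral_mono_AE) (use L int le2 in \<open>auto simp: L2fun_def\<close>)
  also have "\<dots> = K\<^sup>2 * L2ip \<Omega> A A"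
    by (simp add: L2ip_def power2_norm_eq_inner)
  finally show "L2norm \<Omega> B \<le> K * L2norm \<Omega> A"
    unfolding L2norm_def using K by (metis real_sqrt_le_mono real_sqrt_mult real_sqrt_abs abs_of_nonneg)
qed

lemma L2fun_cmult: "L2fun \<Omega> u \<Longrightarrow> L2fun \<Omega> (\<lambda>x. c *\<^sub>R u x)"
  by (auto simp: L2fun_def power_mult_distrib)

lemma integrable_inner_L2fun:
  assumes "L2fun \<Omega> u" "L2fun \<Omega> v"
  shows "integrable (lebesgue_on \<Omega>) (\<lambda>x. u x \<bullet> v x)"
proof (rule Bochner_Integration.integrable_bound)
  show "integrable (lebesgue_on \<Omega>) (\<lambda>x. (norm (u x))\<^sup>2 + (norm (v x))\<^sup>2)"
    using assms by (simp add: L2fun_def)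
  show "(\<lambda>x. u x \<bullet> v x) \<in> borel_measurable (lebesgue_on \<Omega>)"
    using assms by (auto simp: L2fun_def)
  have "\<bar>a \<bullet> b\<bar> \<le> (norm a)\<^sup>2 + (norm b)\<^sup>2" for a b :: 'a
  proof -
    have "2 * \<bar>a \<bullet> b\<bar> \<le> 2 * norm a * norm b"
      using Cauchy_Schwarz_ineq2[of a b] by simp
    then show ?thesis
      using sum_squares_bound[of "norm a" "norm b"] by linarith
  qed
  then show "AE x in lebesgue_on \<Omega>. norm (u x \<bullet> v x) \<le> norm ((norm (u x))\<^sup>2 + (norm (v x))\<^sup>2)"
    by simp
qed

lemma L2fun_add:
  assumes "L2fun \<Omega> u" "L2fun \<Omega> v"
  shows "L2fun \<Omega> (\<lambda>x. u x + v x)"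
proof -
  have "integrable (lebesgue_on \<Omega>) (\<lambda>x. u x \<bullet> u x + 2 * (u x \<bullet> v x) + v x \<bullet> v x)"
    by (intro Bochner_Integration.integrable_add integrable_mult_right integrable_inner_L2fun assms)
  then have "integrable (lebesgue_on \<Omega>) (\<lambda>x. (norm (u x + v x))\<^sup>2)"
    by (simp add: power2_norm_eq_inner inner_add inner_commute algebra_simps)
  then show ?thesis
    using assms by (auto simp: L2fun_def)
qed

lemma L2fun_diff:
  assumes "L2fun \<Omega> u" "L2fun \<Omega> v"
  shows "L2fun \<Omega> (\<lambda>x. u x - v x)"
  using L2fun_add[OF assms(1) L2fun_cmult[OF assms(2), of "-1"]] by simp

lemma L2ip_add_left:
  assumes "L2fun \<Omega> u" "L2fun \<Omega> v" "L2fun \<Omega> w"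
  shows "L2ip \<Omega> (\<lambda>x. u x + v x) w = L2ip \<Omega> u w + L2ip \<Omega> v w"
  using assms by (simp add: L2ip_def inner_add_left integrable_inner_L2fun)

lemma L2ip_diff_left:
  assumes "L2fun \<Omega> u" "L2fun \<Omega> v" "L2fun \<Omega> w"
  shows "L2ip \<Omega> (\<lambda>x. u x - v x) w = L2ip \<Omega> u w - L2ip \<Omega> v w"
  using assms by (simp add: L2ip_def inner_diff_left integrable_inner_L2fun)

lemma L2ip_add_right:
  assumes "L2fun \<Omega> u" "L2fun \<Omega> v" "L2fun \<Omega> w"
  shows "L2ip \<Omega> w (\<lambda>x. u x + v x) = L2ip \<Omega> w u + L2ip \<Omega> w v"
  using L2ip_add_left[OF assms] by (simp add: L2ip_commute)

lemma L2ip_cmult_left: "L2ip \<Omega> (\<lambda>x. c *\<^sub>R u x) w = c * L2ip \<Omega> u w"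
  by (simp add: L2ip_def)

lemma L2ip_cmult_right: "L2ip \<Omega> u (\<lambda>x. c *\<^sub>R w x) = c * L2ip \<Omega> u w"
  by (simp add: L2ip_def)

lemma L2ip_diff_right:
  assumes "L2fun \<Omega> u" "L2fun \<Omega> v" "L2fun \<Omega> w"
  shows "L2ip \<Omega> w (\<lambda>x. u x - v x) = L2ip \<Omega> w u - L2ip \<Omega> w v"
  using L2ip_diff_left[OF assms] by (simp add: L2ip_commute)

lemma L2norm_diff_power2:
  assumes "L2fun \<Omega> u" "L2fun \<Omega> v"
  shows "(L2norm \<Omega> (\<lambda>x. u x - v x))\<^sup>2 = (L2norm \<Omega> u)\<^sup>2 - 2 * L2ip \<Omega> u v + (L2norm \<Omega> v)\<^sup>2"
  using assms L2fun_diff[OF assms]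
  by (simp add: L2norm_power2 L2ip_diff_left L2ip_diff_right L2ip_commute[of \<Omega> v u])

lemma L2ip_Cauchy_Schwarz:
  assumes "L2fun \<Omega> u" "L2fun \<Omega> v"
  shows "\<bar>L2ip \<Omega> u v\<bar> \<le> L2norm \<Omega> u * L2norm \<Omega> v"
proof -
  define a b c where "a = L2ip \<Omega> u u" "b = L2ip \<Omega> v v" "c = L2ip \<Omega> u v"
  have pos: "0 \<le> r\<^sup>2 * a - 2 * (r * s) * c + s\<^sup>2 * b" for r s
    using L2norm_diff_power2[OF L2fun_cmult[OF assms(1), of r] L2fun_cmult[OF assms(2), of s]]
      zero_le_power2[of "L2norm \<Omega> (\<lambda>x. r *\<^sub>R u x - s *\<^sub>R v x)"]
    by (simp add: L2norm_power2 L2ip_cmult_left L2ip_cmult_right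
        a_b_c_def L2ip_commute[of _ v u] power2_eq_square[of r] power2_eq_square[of s] mult_ac)
  have "c\<^sup>2 \<le> a * b"
  proof (cases "a = 0")
    case True
    have "c = 0"
    proof (rule ccontr)
      assume "c \<noteq> 0"
      then show False
        using pos[of "(b + 1) / c" 1] L2ip_nonneg[of \<Omega> v] True by (simp add: a_b_c_def)
    qed
    then show ?thesis using True by simp
  next
    case False
    then have "0 < a" using L2ip_nonneg[of \<Omega> u] by (simp add: a_b_c_def)
    moreover have "0 \<le> a * (a * b - c\<^sup>2)"
      using pos[of c a] by (simp add: algebra_simps power2_eq_square)
    ultimately show ?thesis by (simp add: zero_le_mult_iff)
  qed
  then have "\<bar>c\<bar> \<le> sqrt (a * b)"
    by (metis real_sqrt_abs real_sqrt_le_iff)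
  then show ?thesis
    by (simp add: L2norm_def a_b_c_def real_sqrt_mult)
qed

lemma tendsto_L2ip_left:
  assumes lim: "(\<lambda>k. L2norm \<Omega> (\<lambda>x. a k x - A x)) \<longlonglongrightarrow> 0"
    and "\<And>k. L2fun \<Omega> (a k)" "L2fun \<Omega> A" "L2fun \<Omega> b"
  shows "(\<lambda>k. L2ip \<Omega> (a k) b) \<longlonglongrightarrow> L2ip \<Omega> A b"
proof -
  have "(\<lambda>k. L2ip \<Omega> (a k) b - L2ip \<Omega> A b) \<longlonglongrightarrow> 0"
  proof (rule Lim_null_comparison)
    have "\<bar>L2ip \<Omega> (a k) b - L2ip \<Omega> A b\<bar> \<le> L2norm \<Omega> (\<lambda>x. a k x - A x) * L2norm \<Omega> b" for k
      using L2ip_Cauchy_Schwarz[OF L2fun_diff[OF assms(2)[of k] assms(3)] assms(4)]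
      by (simp add: L2ip_diff_left assms)
    then show "\<forall>\<^sub>F k in sequentially. norm (L2ip \<Omega> (a k) b - L2ip \<Omega> A b) \<le> L2norm \<Omega> (\<lambda>x. a k x - A x) * L2norm \<Omega> b"
      by simp
    show "(\<lambda>k. L2norm \<Omega> (\<lambda>x. a k x - A x) * L2norm \<Omega> b) \<longlonglongrightarrow> 0"
      using tendsto_mult_right[OF lim] by simp
  qed
  then show ?thesis by (rule LIM_zero_cancel)
qed

lemma L2norm_triangle:
  assumes "L2fun \<Omega> u" "L2fun \<Omega> v"
  shows "L2norm \<Omega> (\<lambda>x. u x + v x) \<le> L2norm \<Omega> u + L2norm \<Omega> v"
proof (rule power2_le_imp_le)
  have "(L2norm \<Omega> (\<lambda>x. u x + v x))\<^sup>2 = (L2norm \<Omega> u)\<^sup>2 + 2 * L2ip \<Omega> u v + (L2norm \<Omega> v)\<^sup>2"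
    using assms L2fun_add[OF assms]
    by (simp add: L2norm_power2 L2ip_add_left L2ip_add_right L2ip_commute[of \<Omega> v u])
  also have "\<dots> \<le> (L2norm \<Omega> u + L2norm \<Omega> v)\<^sup>2"
    using L2ip_Cauchy_Schwarz[OF assms] by (simp add: power2_sum)
  finally show "(L2norm \<Omega> (\<lambda>x. u x + v x))\<^sup>2 \<le> (L2norm \<Omega> u + L2norm \<Omega> v)\<^sup>2" .
qed (simp add: L2norm_nonneg)

lemma L2norm_cmult: "L2norm \<Omega> (\<lambda>x. c *\<^sub>R u x) = \<bar>c\<bar> * L2norm \<Omega> u"
proof -
  have "L2ip \<Omega> (\<lambda>x. c *\<^sub>R u x) (\<lambda>x. c *\<^sub>R u x) = c\<^sup>2 * L2ip \<Omega> u u"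
    by (simp add: L2ip_cmult_left L2ip_cmult_right power2_eq_square)
  then show ?thesis by (simp add: L2norm_def real_sqrt_mult)
qed

lemma tendsto_L2norm:
  assumes lim: "(\<lambda>k. L2norm \<Omega> (\<lambda>x. a k x - A x)) \<longlonglongrightarrow> 0"
    and L: "\<And>k. L2fun \<Omega> (a k)" "L2fun \<Omega> A"
  shows "(\<lambda>k. L2norm \<Omega> (a k)) \<longlonglongrightarrow> L2norm \<Omega> A"
proof -
  have "\<bar>L2norm \<Omega> (a k) - L2norm \<Omega> A\<bar> \<le> L2norm \<Omega> (\<lambda>x. a k x - A x)" for k
    using L2norm_triangle[OF L2fun_diff[OF L(1)[of k] L(2)] L(2)]
      L2norm_triangle[OF L2fun_diff[OF L(2) L(1)[of k]] L(1)[of k]]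
      L2norm_cmult[of \<Omega> "-1" "\<lambda>x. a k x - A x"]
    by simp
  then have "(\<lambda>k. L2norm \<Omega> (a k) - L2norm \<Omega> A) \<longlonglongrightarrow> 0"
    by (intro Lim_null_comparison[OF _ lim]) auto
  then show ?thesis by (rule LIM_zero_cancel)
qed

section \<open>Matrix-valued fields\<close>

definition outer :: "real^'n \<Rightarrow> real^'m \<Rightarrow> real^'m^'n" where
  "outer p q = (\<chi> i j. p $ i * q $ j)"

lemma inner_matrix_vector_outer: "(A *v q) \<bullet> p = A \<bullet> outer p q"
  by (simp add: outer_def inner_vec_def matrix_vector_mult_def sum_distrib_left sum_distrib_right mult_ac)

lemma norm_outer: "norm (outer p q) = norm p * norm q"
proof -
  have "norm (outer p q $ i) = \<bar>p $ i\<bar> * norm q" for i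
  proof -
    have "outer p q $ i = p $ i *\<^sub>R q" by (simp add: outer_def vec_eq_iff)
    then show ?thesis by simp
  qed
  then show ?thesis
    by (simp add: norm_vec_def[of "outer p q"] norm_vec_def[of p] L2_set_right_distrib mult.commute)
qed

lemma norm_matrix_vector_mult_le: "norm (A *v x) \<le> norm A * norm (x::real^'n)"
proof -
  have "norm (A *v x) \<le> L2_set (\<lambda>i. norm (A $ i) * norm x) UNIV"
    unfolding norm_vec_def[of "A *v x"]
    by (rule L2_set_mono) (auto simp: matrix_vector_mul_component Cauchy_Schwarz_ineq2)
  also have "\<dots> = norm A * norm x"
    by (simp add: L2_set_left_distrib[symmetric] norm_vec_def[of A])
  finally show ?thesis .
qed

lemma norm_transpose: "norm (transpose A) = norm (A::real^'n^'m)"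
proof -
  have "(norm (transpose A))\<^sup>2 = (norm A)\<^sup>2"
    by (simp add: power2_norm_eq_inner inner_vec_def transpose_def) (rule sum.swap)
  then show ?thesis by simp
qed

lemma abs_trace_le: "\<bar>trace A\<bar> \<le> CARD('n) * norm (A::real^'n^'n)"
proof -
  have "\<bar>trace A\<bar> \<le> (\<Sum>i\<in>UNIV. \<bar>A $ i $ i\<bar>)"
    unfolding trace_def by (rule sum_abs)
  also have "\<dots> \<le> (\<Sum>i\<in>(UNIV::'n set). norm A)"
  proof (rule sum_mono)
    fix i
    show "\<bar>A $ i $ i\<bar> \<le> norm A"
      using component_le_norm_cart[of "A $ i" i] Finite_Cartesian_Product.norm_nth_le[of A i] by linarith
  qed
  finally show ?thesis by simp
qed

lemma inner_scaleR_mat_1: "A \<bullet> (c *\<^sub>R mat 1) = c * trace (A::real^'n^'n)"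
proof -
  have "A \<bullet> mat 1 = trace A"
    by (simp add: inner_vec_def mat_def trace_def if_distrib cong: if_cong)
  then show ?thesis by simp
qed

lemma continuous_on_matrix_vector_mult [continuous_intros]:
  fixes A :: "'a::topological_space \<Rightarrow> real^'n^'m"
  assumes "continuous_on S A" "continuous_on S b"
  shows "continuous_on S (\<lambda>x. A x *v b x)"
  unfolding matrix_vector_mult_def
  by (intro continuous_intros continuous_on_vec_lambda assms)

lemma continuous_on_trace [continuous_intros]:
  fixes A :: "'a::topological_space \<Rightarrow> real^'n^'n"
  assumes "continuous_on S A"
  shows "continuous_on S (\<lambda>x. trace (A x))"
  unfolding trace_def by (intro continuous_intros assms)

lemma continuous_on_outer [continuous_intros]:
  assumes "continuous_on S p" "continuous_on S q"
  shows "continuous_on S (\<lambda>x. outer (p x) (q x))"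
  unfolding outer_def by (intro continuous_intros continuous_on_vec_lambda assms)

lemma continuous_on_transpose [continuous_intros]:
  fixes A :: "'a::topological_space \<Rightarrow> real^'n^'m"
  assumes "continuous_on S A"
  shows "continuous_on S (\<lambda>x. transpose (A x))"
  unfolding transpose_def by (intro continuous_intros continuous_on_vec_lambda assms)

lemma borel_measurable_matrix_vector_mult [measurable (raw)]:
  fixes A :: "'a \<Rightarrow> real^'n^'m"
  assumes "A \<in> borel_measurable M" "b \<in> borel_measurable M"
  shows "(\<lambda>x. A x *v b x) \<in> borel_measurable M"
  using assms by (rule borel_measurable_continuous_Pair) (intro continuous_intros)

lemma borel_measurable_outer [measurable (raw)]:
  assumes "p \<in> borel_measurable M" "q \<in> borel_measurable M"
  shows "(\<lambda>x. outer (p x) (q x)) \<in> borel_measurable M"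
  using assms by (rule borel_measurable_continuous_Pair) (intro continuous_intros)

lemma borel_measurable_trace [measurable (raw)]:
  fixes A :: "'a \<Rightarrow> real^'n^'n"
  assumes "A \<in> borel_measurable M"
  shows "(\<lambda>x. trace (A x)) \<in> borel_measurable M"
  using borel_measurable_continuous_on[OF continuous_on_trace[OF continuous_on_id] assms] .

lemma borel_measurable_transpose [measurable (raw)]:
  fixes A :: "'a \<Rightarrow> real^'n^'m"
  assumes "A \<in> borel_measurable M"
  shows "(\<lambda>x. transpose (A x)) \<in> borel_measurable M"
  using borel_measurable_continuous_on[OF continuous_on_transpose[OF continuous_on_id] assms] .

section \<open>Compactly supported smooth fields\<close>

lemma L2fun_continuous:
  fixes f :: "pt \<Rightarrow> 'a::euclidean_space"
  assumes \<Omega>: "open \<Omega>" "bounded \<Omega>" and f: "continuous_on UNIV f"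
  shows "L2fun \<Omega> f"
proof -
  have fin: "finite_measure (lebesgue_on \<Omega>)"
    using \<Omega> by (simp add: finite_measure_lebesgue_on lmeasurable_open)
  have meas: "f \<in> borel_measurable (lebesgue_on \<Omega>)"
    using f by (intro measurable_restrict_space1 measurable_completion) (simp add: borel_measurable_continuous_onI)
  have "compact (f ` closure \<Omega>)"
    using \<Omega> f by (intro compact_continuous_image) (auto intro: continuous_on_subset)
  then obtain B where B: "\<And>x. x \<in> closure \<Omega> \<Longrightarrow> norm (f x) \<le> B"
    using compact_imp_bounded bounded_iff by (metis imageI)
  have "AE x in lebesgue_on \<Omega>. norm ((norm (f x))\<^sup>2) \<le> B\<^sup>2"
    using B closure_subset by (intro AE_I2) (auto intro!: power_mono)
  then show ?thesis
    unfolding L2fun_def using meas by (auto intro!: finite_measure.integrable_const_bound[OF fin])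
qed

lemma Cc1_continuous:
  assumes "Cc1 \<Omega> \<phi> D\<phi>"
  shows "continuous_on UNIV \<phi>" "continuous_on UNIV D\<phi>"
  using assms has_derivative_continuous unfolding Cc1_def continuous_on_eq_continuous_at[OF open_UNIV] by blast+

lemma Cc1_integration_by_parts:
  assumes \<Omega>: "open \<Omega>" "bounded \<Omega>"
    and \<phi>: "Cc1 \<Omega> \<phi> D\<phi>" and \<psi>: "Cc1 \<Omega> \<psi> D\<psi>" and \<eta>: "Cc1 \<Omega> \<eta> D\<eta>"
  shows "L2ip \<Omega> (\<lambda>x. D\<eta> x *v \<phi> x) \<psi> + L2ip \<Omega> (\<lambda>x. D\<psi> x *v \<phi> x) \<eta>
    + L2ip \<Omega> (\<lambda>x. trace (D\<phi> x) *\<^sub>R \<psi> x) \<eta> = 0"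
proof -
  note cont [continuous_intros] = Cc1_continuous[OF \<phi>] Cc1_continuous[OF \<psi>] Cc1_continuous[OF \<eta>]
  obtain K where K: "compact K" "K \<subseteq> \<Omega>" "\<And>x. x \<notin> K \<Longrightarrow> \<phi> x = 0"
    using \<phi> unfolding Cc1_def by blast
  have der: "\<And>x. (\<phi> has_derivative (\<lambda>k. D\<phi> x *v k)) (at x)"
     "\<And>x. (\<psi> has_derivative (\<lambda>k. D\<psi> x *v k)) (at x)"
     "\<And>x. (\<eta> has_derivative (\<lambda>k. D\<eta> x *v k)) (at x)"
    using \<phi> \<psi> \<eta> by (auto simp: Cc1_def)
  define V' where "V' = (\<lambda>j x k. (\<psi> x \<bullet> \<eta> x) * (D\<phi> x *v k) $ j + (\<psi> x \<bullet> (D\<eta> x *v k) + (D\<psi> x *v k) \<bullet> \<eta> x) * \<phi> x $ j)"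
  have V': "has_bochner_integral (lebesgue_on \<Omega>) (\<lambda>x. V' j x (axis j 1)) 0" for j
  proof (rule has_bochner_integral_directional_derivative[OF _ _ K(1) _ \<Omega>(1) K(2)])
    show "((\<lambda>x. (\<psi> x \<bullet> \<eta> x) * \<phi> x $ j) has_derivative V' j x) (at x)" for x
      unfolding V'_def by (rule derivative_eq_intros der bounded_linear.has_derivative[OF bounded_linear_vec_nth] refl)+
    show "continuous_on UNIV (\<lambda>x. V' j x (axis j 1))"
      unfolding V'_def by (intro continuous_intros continuous_on_component)
  qed (use K(3) in auto)
  have "has_bochner_integral (lebesgue_on \<Omega>) (\<lambda>x. \<Sum>j\<in>UNIV. V' j x (axis j 1)) (\<Sum>j\<in>(UNIV::2 set). 0)"
    by (intro has_bochner_integral_sum V')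
  moreover have "(\<Sum>j\<in>UNIV. V' j x (axis j 1)) = (D\<eta> x *v \<phi> x) \<bullet> \<psi> x + (D\<psi> x *v \<phi> x) \<bullet> \<eta> x + (trace (D\<phi> x) *\<^sub>R \<psi> x) \<bullet> \<eta> x" for x
    by (simp add: V'_def sum_2 inner_vec_def matrix_vector_mult_def axis_def trace_def algebra_simps)
  ultimately have "(LINT x|lebesgue_on \<Omega>. (D\<eta> x *v \<phi> x) \<bullet> \<psi> x + (D\<psi> x *v \<phi> x) \<bullet> \<eta> x + (trace (D\<phi> x) *\<^sub>R \<psi> x) \<bullet> \<eta> x) = 0"
    by (simp add: has_bochner_integral_iff)
  moreover have "L2fun \<Omega> \<psi>" "L2fun \<Omega> \<eta>" "L2fun \<Omega> (\<lambda>x. D\<eta> x *v \<phi> x)" "L2fun \<Omega> (\<lambda>x. D\<psi> x *v \<phi> x)" "L2fun \<Omega> (\<lambda>x. trace (D\<phi> x) *\<^sub>R \<psi> x)"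
    by (intro L2fun_continuous \<Omega> continuous_intros)+
  then have "integrable (lebesgue_on \<Omega>) (\<lambda>x. (D\<eta> x *v \<phi> x) \<bullet> \<psi> x)"
    "integrable (lebesgue_on \<Omega>) (\<lambda>x. (D\<psi> x *v \<phi> x) \<bullet> \<eta> x)"
    "integrable (lebesgue_on \<Omega>) (\<lambda>x. (trace (D\<phi> x) *\<^sub>R \<psi> x) \<bullet> \<eta> x)"
    using integrable_inner_L2fun by blast+
  ultimately show ?thesis
    unfolding L2ip_def by simp
qed

text \<open>Obtained by integrating $\partial_1 (x_1 |\phi|^2)$.\<close>

lemma Cc1_Poincare:
  assumes \<Omega>: "open \<Omega>" "bounded \<Omega>" and R: "\<And>x. x \<in> \<Omega> \<Longrightarrow> norm x \<le> R" and R0: "0 \<le> R"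
    and \<phi>: "Cc1 \<Omega> \<phi> D\<phi>"
  shows "L2norm \<Omega> \<phi> \<le> 2 * R * L2norm \<Omega> D\<phi>"
proof -
  note cont [continuous_intros] = Cc1_continuous[OF \<phi>]
  obtain K where K: "compact K" "K \<subseteq> \<Omega>" "\<And>x. x \<notin> K \<Longrightarrow> \<phi> x = 0"
    using \<phi> unfolding Cc1_def by blast
  have der: "\<And>x. (\<phi> has_derivative (\<lambda>k. D\<phi> x *v k)) (at x)"
    using \<phi> by (auto simp: Cc1_def)
  define B where "B = (\<lambda>x::pt. (2 * x $ 1) *\<^sub>R (D\<phi> x *v axis 1 1))"
  have cB: "continuous_on UNIV B"
    unfolding B_def by (intro continuous_intros continuous_on_component)
  have "has_bochner_integral (lebesgue_on \<Omega>)
      (\<lambda>x. (axis 1 1 :: pt) $ 1 * (\<phi> x \<bullet> \<phi> x) + x $ 1 * (2 * (\<phi> x \<bullet> (D\<phi> x *v axis 1 1)))) 0"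
  proof (rule has_bochner_integral_directional_derivative[OF _ _ K(1) _ \<Omega>(1) K(2),
      where F' = "\<lambda>x k. k $ 1 * (\<phi> x \<bullet> \<phi> x) + x $ 1 * (2 * (\<phi> x \<bullet> (D\<phi> x *v k)))"])
    show "((\<lambda>x. x $ 1 * (\<phi> x \<bullet> \<phi> x)) has_derivative
        (\<lambda>k. k $ 1 * (\<phi> x \<bullet> \<phi> x) + x $ 1 * (2 * (\<phi> x \<bullet> (D\<phi> x *v k))))) (at x)" for x
      by (rule derivative_eq_intros der bounded_linear.has_derivative[OF bounded_linear_vec_nth] refl)+
        (auto simp: algebra_simps inner_commute)
    show "continuous_on UNIV (\<lambda>x. (axis 1 1 :: pt) $ 1 * (\<phi> x \<bullet> \<phi> x) + x $ 1 * (2 * (\<phi> x \<bullet> (D\<phi> x *v axis 1 1))))"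
      by (intro continuous_intros continuous_on_component)
  qed (use K(3) in auto)
  then have "(LINT x|lebesgue_on \<Omega>. \<phi> x \<bullet> \<phi> x + \<phi> x \<bullet> B x) = 0"
    by (simp add: B_def has_bochner_integral_iff mult_ac)
  moreover have L: "L2fun \<Omega> \<phi>" "L2fun \<Omega> B" "L2fun \<Omega> D\<phi>"
    using cB by (intro L2fun_continuous \<Omega> continuous_intros; assumption)+
  ultimately have "(L2norm \<Omega> \<phi>)\<^sup>2 = - L2ip \<Omega> \<phi> B"
    unfolding L2norm_power2 by (simp add: L2ip_def integrable_inner_L2fun)
  also have "\<dots> \<le> L2norm \<Omega> \<phi> * L2norm \<Omega> B"
    using L2ip_Cauchy_Schwarz[OF L(1,2)] by linarith
  also have "L2norm \<Omega> B \<le> 2 * R * L2norm \<Omega> D\<phi>"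
  proof (rule L2fun_bound(2)[OF L(3) L2fun_measurable[OF L(2)]])
    have "norm (B x) \<le> 2 * R * norm (D\<phi> x)" if "x \<in> \<Omega>" for x
    proof -
      have "norm (D\<phi> x *v axis 1 1) \<le> norm (D\<phi> x)"
        using norm_matrix_vector_mult_le[of "D\<phi> x" "axis 1 1"] by simp
      moreover have "\<bar>x $ 1\<bar> \<le> R"
        using component_le_norm_cart[of x 1] R[OF that] by linarith
      ultimately have "\<bar>x $ 1\<bar> * norm (D\<phi> x *v axis 1 1) \<le> R * norm (D\<phi> x)"
        using R0 by (intro mult_mono) auto
      then show ?thesis by (simp add: B_def abs_mult)
    qed
    then show "AE x in lebesgue_on \<Omega>. norm (B x) \<le> 2 * R * norm (D\<phi> x)"
      by (intro AE_I2) simp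
  qed (use R0 in auto)
  finally have "L2norm \<Omega> \<phi> * L2norm \<Omega> \<phi> \<le> L2norm \<Omega> \<phi> * (2 * R * L2norm \<Omega> D\<phi>)"
    using L2norm_nonneg[of \<Omega> \<phi>] by (simp add: power2_eq_square mult_left_mono)
  then show ?thesis
    using L2norm_nonneg[of \<Omega> \<phi>] L2norm_nonneg[of \<Omega> D\<phi>] R0
    by (cases "L2norm \<Omega> \<phi> = 0") (auto simp: mult_le_cancel_left)
qed

section \<open>Fields in $H^1_0$\<close>

lemma H10_grad_L2fun:
  assumes "H10_grad \<Omega> v G"
  shows "L2fun \<Omega> v" "L2fun \<Omega> G"
  using assms by (auto simp: H10_grad_def)

lemma H10_grad_grad: "v \<in> H10 \<Omega> \<Longrightarrow> H10_grad \<Omega> v (grad \<Omega> v)"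
  unfolding H10_def grad_def mem_Collect_eq by (rule someI_ex[of "H10_grad \<Omega> v"])

lemma H10_grad_approx:
  assumes \<Omega>: "open \<Omega>" "bounded \<Omega>" and "H10_grad \<Omega> v G"
  obtains \<phi> D\<phi> where "\<forall>k::nat. Cc1 \<Omega> (\<phi> k) (D\<phi> k)"
    "\<forall>k. L2fun \<Omega> (\<phi> k)" "\<forall>k. L2fun \<Omega> (D\<phi> k)"
    "(\<lambda>k. L2norm \<Omega> (\<lambda>x. \<phi> k x - v x)) \<longlonglongrightarrow> 0"
    "(\<lambda>k. L2norm \<Omega> (\<lambda>x. D\<phi> k x - G x)) \<longlonglongrightarrow> 0"
proof -
  obtain \<phi> D\<phi> where *: "\<forall>k::nat. Cc1 \<Omega> (\<phi> k) (D\<phi> k)"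
    "(\<lambda>k. L2norm \<Omega> (\<lambda>x. \<phi> k x - v x)) \<longlonglongrightarrow> 0"
    "(\<lambda>k. L2norm \<Omega> (\<lambda>x. D\<phi> k x - G x)) \<longlonglongrightarrow> 0"
    using assms(3) unfolding H10_grad_def by blast
  show ?thesis
    by (rule that[OF *(1) _ _ *(2,3)])
      (intro allI L2fun_continuous[OF \<Omega>] Cc1_continuous[OF *(1)[rule_format]])+
qed

lemma Cc1_diff:
  assumes "Cc1 \<Omega> \<phi> D\<phi>" "Cc1 \<Omega> \<psi> D\<psi>"
  shows "Cc1 \<Omega> (\<lambda>x. \<phi> x - \<psi> x) (\<lambda>x. D\<phi> x - D\<psi> x)"
proof -
  obtain K where K: "compact K" "K \<subseteq> \<Omega>" "\<And>x. x \<notin> K \<Longrightarrow> \<phi> x = 0"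
    using assms(1) unfolding Cc1_def by blast
  obtain L where L: "compact L" "L \<subseteq> \<Omega>" "\<And>x. x \<notin> L \<Longrightarrow> \<psi> x = 0"
    using assms(2) unfolding Cc1_def by blast
  have "compact (K \<union> L) \<and> K \<union> L \<subseteq> \<Omega> \<and> (\<forall>x. x \<notin> K \<union> L \<longrightarrow> \<phi> x - \<psi> x = 0)"
    using K L by auto
  then have "\<exists>M. compact M \<and> M \<subseteq> \<Omega> \<and> (\<forall>x. x \<notin> M \<longrightarrow> \<phi> x - \<psi> x = 0)"
    by blast
  moreover have "((\<lambda>x. \<phi> x - \<psi> x) has_derivative (\<lambda>k. (D\<phi> x - D\<psi> x) *v k)) (at x)" for x
    using assms unfolding Cc1_def matrix_vector_mult_diff_rdistrib
    by (intro has_derivative_diff) auto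
  ultimately show ?thesis
    using assms by (auto simp: Cc1_def intro!: continuous_intros)
qed

lemma tendsto_L2norm_diff:
  assumes "(\<lambda>k. L2norm \<Omega> (\<lambda>x. a k x - A x)) \<longlonglongrightarrow> 0" "(\<lambda>k. L2norm \<Omega> (\<lambda>x. b k x - B x)) \<longlonglongrightarrow> 0"
    and "\<And>k. L2fun \<Omega> (a k)" "L2fun \<Omega> A" "\<And>k. L2fun \<Omega> (b k)" "L2fun \<Omega> B"
  shows "(\<lambda>k. L2norm \<Omega> (\<lambda>x. (a k x - b k x) - (A x - B x))) \<longlonglongrightarrow> 0"
proof (rule Lim_null_comparison)
  have "L2norm \<Omega> (\<lambda>x. (a k x - b k x) - (A x - B x)) \<le> L2norm \<Omega> (\<lambda>x. a k x - A x) + L2norm \<Omega> (\<lambda>x. b k x - B x)" for k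
    using L2norm_triangle[OF L2fun_diff[OF assms(3)[of k] assms(4)] L2fun_cmult[OF L2fun_diff[OF assms(5)[of k] assms(6)], of "-1"]]
      L2norm_cmult[of \<Omega> "-1" "\<lambda>x. b k x - B x"]
    by (simp add: algebra_simps)
  then show "\<forall>\<^sub>F k in sequentially. norm (L2norm \<Omega> (\<lambda>x. (a k x - b k x) - (A x - B x)))
      \<le> L2norm \<Omega> (\<lambda>x. a k x - A x) + L2norm \<Omega> (\<lambda>x. b k x - B x)"
    by (simp add: L2norm_nonneg)
  show "(\<lambda>k. L2norm \<Omega> (\<lambda>x. a k x - A x) + L2norm \<Omega> (\<lambda>x. b k x - B x)) \<longlonglongrightarrow> 0"
    using tendsto_add[OF assms(1,2)] by simp
qed

lemma H10_grad_diff: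
  assumes \<Omega>: "open \<Omega>" "bounded \<Omega>" and u: "H10_grad \<Omega> u Gu" and v: "H10_grad \<Omega> v Gv"
  shows "H10_grad \<Omega> (\<lambda>x. u x - v x) (\<lambda>x. Gu x - Gv x)"
proof -
  obtain \<phi> D\<phi> where a_all: "\<forall>k::nat. Cc1 \<Omega> (\<phi> k) (D\<phi> k)"
    "\<forall>k. L2fun \<Omega> (\<phi> k)" "\<forall>k. L2fun \<Omega> (D\<phi> k)"
    "(\<lambda>k. L2norm \<Omega> (\<lambda>x. \<phi> k x - u x)) \<longlonglongrightarrow> 0"
    "(\<lambda>k. L2norm \<Omega> (\<lambda>x. D\<phi> k x - Gu x)) \<longlonglongrightarrow> 0"
    using H10_grad_approx[OF \<Omega> u] by blast
  note a = a_all[rule_format]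
  obtain \<psi> D\<psi> where b_all: "\<forall>k::nat. Cc1 \<Omega> (\<psi> k) (D\<psi> k)"
    "\<forall>k. L2fun \<Omega> (\<psi> k)" "\<forall>k. L2fun \<Omega> (D\<psi> k)"
    "(\<lambda>k. L2norm \<Omega> (\<lambda>x. \<psi> k x - v x)) \<longlonglongrightarrow> 0"
    "(\<lambda>k. L2norm \<Omega> (\<lambda>x. D\<psi> k x - Gv x)) \<longlonglongrightarrow> 0"
    using H10_grad_approx[OF \<Omega> v] by blast
  note b = b_all[rule_format]
  note L = H10_grad_L2fun[OF u] H10_grad_L2fun[OF v]
  show ?thesis
    unfolding H10_grad_def
  proof (intro conjI exI allI)
    show "Cc1 \<Omega> (\<lambda>x. \<phi> k x - \<psi> k x) (\<lambda>x. D\<phi> k x - D\<psi> k x)" for k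
      by (rule Cc1_diff a b)+
    show "L2fun \<Omega> (\<lambda>x. u x - v x)" "L2fun \<Omega> (\<lambda>x. Gu x - Gv x)"
      by (intro L2fun_diff L)+
    show "(\<lambda>k. L2norm \<Omega> (\<lambda>x. \<phi> k x - \<psi> k x - (u x - v x))) \<longlonglongrightarrow> 0"
      by (intro tendsto_L2norm_diff L a b)
    show "(\<lambda>k. L2norm \<Omega> (\<lambda>x. D\<phi> k x - D\<psi> k x - (Gu x - Gv x))) \<longlonglongrightarrow> 0"
      by (intro tendsto_L2norm_diff L a b)
  qed
qed

lemma H10_Poincare:
  assumes \<Omega>: "open \<Omega>" "bounded \<Omega>"
  obtains C where "0 \<le> C" "\<And>v G. H10_grad \<Omega> v G \<Longrightarrow> L2norm \<Omega> v \<le> C * L2norm \<Omega> G"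
proof -
  obtain R where R: "0 < R" "\<And>x. x \<in> \<Omega> \<Longrightarrow> norm x \<le> R"
    using \<Omega>(2) bounded_pos by metis
  have "L2norm \<Omega> v \<le> 2 * R * L2norm \<Omega> G" if H: "H10_grad \<Omega> v G" for v G
  proof -
    obtain \<phi> D\<phi> where a_all: "\<forall>k::nat. Cc1 \<Omega> (\<phi> k) (D\<phi> k)"
      "\<forall>k. L2fun \<Omega> (\<phi> k)" "\<forall>k. L2fun \<Omega> (D\<phi> k)"
      "(\<lambda>k. L2norm \<Omega> (\<lambda>x. \<phi> k x - v x)) \<longlonglongrightarrow> 0"
      "(\<lambda>k. L2norm \<Omega> (\<lambda>x. D\<phi> k x - G x)) \<longlonglongrightarrow> 0"
      using H10_grad_approx[OF \<Omega> H] by blast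
    note a = a_all[rule_format]
    show ?thesis
    proof (rule LIMSEQ_le)
      show "(\<lambda>k. L2norm \<Omega> (\<phi> k)) \<longlonglongrightarrow> L2norm \<Omega> v"
        by (intro tendsto_L2norm a H10_grad_L2fun[OF H])
      show "(\<lambda>k. 2 * R * L2norm \<Omega> (D\<phi> k)) \<longlonglongrightarrow> 2 * R * L2norm \<Omega> G"
        by (intro tendsto_mult_left tendsto_L2norm a H10_grad_L2fun[OF H])
      show "\<exists>N. \<forall>n\<ge>N. L2norm \<Omega> (\<phi> n) \<le> 2 * R * L2norm \<Omega> (D\<phi> n)"
        using Cc1_Poincare[OF \<Omega> R(2) _ a(1)] R(1) by auto
    qed
  qed
  then show ?thesis using that[of "2 * R"] R(1) by auto
qed

lemma L2ip_le_dualnorm: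
  assumes \<Omega>: "open \<Omega>" "bounded \<Omega>" and f: "L2fun \<Omega> f" and v: "v \<in> H10 \<Omega>"
  shows "L2ip \<Omega> f v \<le> dualnorm \<Omega> f * gradnorm \<Omega> v"
proof -
  obtain C where C: "0 \<le> C" "\<And>v G. H10_grad \<Omega> v G \<Longrightarrow> L2norm \<Omega> v \<le> C * L2norm \<Omega> G"
    using H10_Poincare[OF \<Omega>] by blast
  have le: "L2ip \<Omega> f w \<le> L2norm \<Omega> f * C * gradnorm \<Omega> w" if "w \<in> H10 \<Omega>" for w
  proof -
    have "L2ip \<Omega> f w \<le> L2norm \<Omega> f * L2norm \<Omega> w"
      using L2ip_Cauchy_Schwarz[OF f H10_grad_L2fun(1)[OF H10_grad_grad[OF that]]] by linarith
    also have "\<dots> \<le> L2norm \<Omega> f * (C * gradnorm \<Omega> w)"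
      using C(2)[OF H10_grad_grad[OF that]] by (intro mult_left_mono) (simp_all add: gradnorm_def L2norm_nonneg)
    finally show ?thesis by (simp add: mult_ac)
  qed
  show ?thesis
  proof (cases "gradnorm \<Omega> v = 0")
    case True
    then show ?thesis using le[OF v] by simp
  next
    case False
    have pos: "0 \<le> gradnorm \<Omega> w" for w by (simp add: gradnorm_def L2norm_nonneg)
    have "L2ip \<Omega> f v / gradnorm \<Omega> v \<le> dualnorm \<Omega> f"
      unfolding dualnorm_def
    proof (rule cSup_upper)
      show "bdd_above {L2ip \<Omega> f v / gradnorm \<Omega> v |v. v \<in> H10 \<Omega> \<and> gradnorm \<Omega> v \<noteq> 0}"
      proof (rule bdd_aboveI, safe)
        fix w assume "w \<in> H10 \<Omega>" "gradnorm \<Omega> w \<noteq> 0"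
        then show "L2ip \<Omega> f w / gradnorm \<Omega> w \<le> L2norm \<Omega> f * C"
          using le[of w] pos[of w] by (simp add: divide_le_eq)
      qed
    qed (use v False in blast)
    then show ?thesis
      using False pos[of v] by (simp add: divide_le_eq)
  qed
qed

lemma L2fun_mult_bounded:
  assumes "L2fun \<Omega> A" "b \<in> borel_measurable (lebesgue_on \<Omega>)" "AE x in lebesgue_on \<Omega>. norm (b x) \<le> M"
    and "B \<in> borel_measurable (lebesgue_on \<Omega>)" "\<And>x. norm (B x) \<le> c * norm (b x) * norm (A x)" "0 \<le> c" "0 \<le> M"
  shows "L2fun \<Omega> B" "L2norm \<Omega> B \<le> c * M * L2norm \<Omega> A"
proof -
  have "AE x in lebesgue_on \<Omega>. norm (B x) \<le> c * M * norm (A x)"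
    using assms(3)
  proof (rule AE_mp, intro AE_I2 impI)
    fix x assume "norm (b x) \<le> M"
    then have "c * norm (b x) * norm (A x) \<le> c * M * norm (A x)"
      using assms(6) by (intro mult_right_mono mult_left_mono) auto
    then show "norm (B x) \<le> c * M * norm (A x)"
      using assms(5)[of x] by linarith
  qed
  then show "L2fun \<Omega> B" "L2norm \<Omega> B \<le> c * M * L2norm \<Omega> A"
    using assms(6,7) L2fun_bound[OF assms(1,4), of "c * M"] by auto
qed

lemma L2fun_matrix_vector_mult:
  fixes A :: "pt \<Rightarrow> real^'n^'m"
  assumes "L2fun \<Omega> A" "b \<in> borel_measurable (lebesgue_on \<Omega>)" "AE x in lebesgue_on \<Omega>. norm (b x) \<le> M" "0 \<le> M"
  shows "L2fun \<Omega> (\<lambda>x. A x *v b x)" "L2norm \<Omega> (\<lambda>x. A x *v b x) \<le> M * L2norm \<Omega> A"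
proof -
  have le: "norm (A x *v b x) \<le> 1 * norm (b x) * norm (A x)" for x
    using norm_matrix_vector_mult_le[of "A x" "b x"] by (simp add: mult.commute)
  note m = borel_measurable_matrix_vector_mult[OF L2fun_measurable[OF assms(1)] assms(2)]
  show "L2fun \<Omega> (\<lambda>x. A x *v b x)" "L2norm \<Omega> (\<lambda>x. A x *v b x) \<le> M * L2norm \<Omega> A"
    using L2fun_mult_bounded[OF assms(1-3) m le _ assms(4)] by simp_all
qed

lemma L2fun_transpose:
  fixes A :: "pt \<Rightarrow> real^'n^'m"
  shows "L2fun \<Omega> A \<Longrightarrow> L2fun \<Omega> (\<lambda>x. transpose (A x))"
  by (simp add: L2fun_def norm_transpose borel_measurable_transpose)

lemma L2fun_trace_scaleR:
  fixes A :: "pt \<Rightarrow> real^'n^'n" and M :: real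
  assumes "L2fun \<Omega> A" "b \<in> borel_measurable (lebesgue_on \<Omega>)" "AE x in lebesgue_on \<Omega>. norm (b x) \<le> M" "0 \<le> M"
  shows "L2fun \<Omega> (\<lambda>x. trace (A x) *\<^sub>R b x)" "L2norm \<Omega> (\<lambda>x. trace (A x) *\<^sub>R b x) \<le> CARD('n) * M * L2norm \<Omega> A"
proof -
  have "norm (trace (A x) *\<^sub>R b x) \<le> CARD('n) * norm (b x) * norm (A x)" for x
    using mult_right_mono[OF abs_trace_le[of "A x"], of "norm (b x)"] by (simp add: mult_ac)
  then show "L2fun \<Omega> (\<lambda>x. trace (A x) *\<^sub>R b x)" "L2norm \<Omega> (\<lambda>x. trace (A x) *\<^sub>R b x) \<le> CARD('n) * M * L2norm \<Omega> A"
    using L2fun_mult_bounded[OF assms(1-3), of "\<lambda>x. trace (A x) *\<^sub>R b x" "CARD('n)"] assms(4)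
      borel_measurable_scaleR[OF borel_measurable_trace[OF L2fun_measurable[OF assms(1)]] assms(2)]
    by simp_all
qed

lemma L2fun_outer:
  assumes "L2fun \<Omega> a" "b \<in> borel_measurable (lebesgue_on \<Omega>)" "AE x in lebesgue_on \<Omega>. norm (b x) \<le> M" "0 \<le> M"
  shows "L2fun \<Omega> (\<lambda>x. outer (a x) (b x))"
  using L2fun_mult_bounded(1)[OF assms(1-3), of "\<lambda>x. outer (a x) (b x)" 1] assms(4)
    borel_measurable_outer[OF L2fun_measurable[OF assms(1)] assms(2)]
  by (simp add: norm_outer mult.commute)

lemma Cc1_bounded:
  assumes "Cc1 \<Omega> \<phi> D\<phi>" and "bounded \<Omega>"
  obtains M where "0 \<le> M" "AE x in lebesgue_on \<Omega>. norm (\<phi> x) \<le> M"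
proof -
  have "compact (\<phi> ` closure \<Omega>)"
    using assms by (intro compact_continuous_image) (auto intro: continuous_on_subset Cc1_continuous)
  then obtain M where M: "\<And>x. x \<in> closure \<Omega> \<Longrightarrow> norm (\<phi> x) \<le> M"
    using compact_imp_bounded bounded_iff by (metis imageI)
  have "norm (\<phi> x) \<le> max 0 M" if "x \<in> \<Omega>" for x
    using M[of x] that closure_subset[of \<Omega>] by (auto intro: max.coboundedI2)
  then show ?thesis
    by (intro that[of "max 0 M"] AE_I2) auto
qed

text \<open>The three fields are replaced by smooth ones and the limits taken one after the other, in
  \<^term>\<open>v\<close> last: this avoids any uniform bound on the approximants and uses only the
  boundedness of \<^term>\<open>u\<close> and \<^term>\<open>w\<close>.\<close>

lemma H10_integration_by_parts:
  assumes \<Omega>: "open \<Omega>" "bounded \<Omega>"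
    and v: "H10_grad \<Omega> v Gv" and u: "H10_grad \<Omega> u Gu" and w: "H10_grad \<Omega> w Gw"
    and ub: "AE x in lebesgue_on \<Omega>. norm (u x) \<le> Mu" "0 \<le> Mu"
    and wb: "AE x in lebesgue_on \<Omega>. norm (w x) \<le> Mw" "0 \<le> Mw"
  shows "L2ip \<Omega> (\<lambda>x. Gw x *v v x) u + L2ip \<Omega> (\<lambda>x. Gu x *v v x) w
    + L2ip \<Omega> (\<lambda>x. trace (Gv x) *\<^sub>R u x) w = 0"
proof -
  note L = H10_grad_L2fun[OF v] H10_grad_L2fun[OF u] H10_grad_L2fun[OF w]
  note meas = L[THEN L2fun_measurable]
  have smooth2: "L2ip \<Omega> (\<lambda>x. Gw x *v \<phi> x) \<psi> + L2ip \<Omega> (\<lambda>x. D\<psi> x *v \<phi> x) w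
    + L2ip \<Omega> (\<lambda>x. trace (D\<phi> x) *\<^sub>R \<psi> x) w = 0"
    if \<phi>: "Cc1 \<Omega> \<phi> D\<phi>" and \<psi>: "Cc1 \<Omega> \<psi> D\<psi>" for \<phi> D\<phi> \<psi> D\<psi>
  proof -
    obtain \<eta> D\<eta> where a_all: "\<forall>k::nat. Cc1 \<Omega> (\<eta> k) (D\<eta> k)"
      "\<forall>k. L2fun \<Omega> (\<eta> k)" "\<forall>k. L2fun \<Omega> (D\<eta> k)"
      "(\<lambda>k. L2norm \<Omega> (\<lambda>x. \<eta> k x - w x)) \<longlonglongrightarrow> 0"
      "(\<lambda>k. L2norm \<Omega> (\<lambda>x. D\<eta> k x - Gw x)) \<longlonglongrightarrow> 0"
      using H10_grad_approx[OF \<Omega> w] by blast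
    note a = a_all[rule_format]
    note c = Cc1_continuous[OF \<phi>] Cc1_continuous[OF \<psi>]
    have e: "L2ip \<Omega> (\<lambda>x. A x *v \<phi> x) \<psi> = L2ip \<Omega> A (\<lambda>x. outer (\<psi> x) (\<phi> x))" for A
      by (simp add: L2ip_def inner_matrix_vector_outer)
    let ?T = "\<lambda>w Gw. L2ip \<Omega> Gw (\<lambda>x. outer (\<psi> x) (\<phi> x)) + L2ip \<Omega> w (\<lambda>x. D\<psi> x *v \<phi> x)
        + L2ip \<Omega> w (\<lambda>x. trace (D\<phi> x) *\<^sub>R \<psi> x)"
    have "(\<lambda>k. ?T (\<eta> k) (D\<eta> k)) \<longlonglongrightarrow> ?T w Gw"
      by (intro tendsto_add tendsto_L2ip_left a L L2fun_continuous[OF \<Omega>] continuous_intros c)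
    moreover have "?T (\<eta> k) (D\<eta> k) = 0" for k
      using Cc1_integration_by_parts[OF \<Omega> \<phi> \<psi> a(1)[of k]] by (simp add: e L2ip_commute[of _ "\<eta> k"])
    ultimately have "?T w Gw = 0" by (simp add: LIMSEQ_const_iff)
    then show ?thesis by (simp add: e L2ip_commute[of _ w])
  qed
  have smooth1: "L2ip \<Omega> (\<lambda>x. Gw x *v \<phi> x) u + L2ip \<Omega> (\<lambda>x. Gu x *v \<phi> x) w
    + L2ip \<Omega> (\<lambda>x. trace (D\<phi> x) *\<^sub>R u x) w = 0"
    if \<phi>: "Cc1 \<Omega> \<phi> D\<phi>" for \<phi> D\<phi>
  proof -
    obtain \<psi> D\<psi> where a_all: "\<forall>k::nat. Cc1 \<Omega> (\<psi> k) (D\<psi> k)"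
      "\<forall>k. L2fun \<Omega> (\<psi> k)" "\<forall>k. L2fun \<Omega> (D\<psi> k)"
      "(\<lambda>k. L2norm \<Omega> (\<lambda>x. \<psi> k x - u x)) \<longlonglongrightarrow> 0"
      "(\<lambda>k. L2norm \<Omega> (\<lambda>x. D\<psi> k x - Gu x)) \<longlonglongrightarrow> 0"
      using H10_grad_approx[OF \<Omega> u] by blast
    note a = a_all[rule_format]
    obtain M where M: "0 \<le> M" "AE x in lebesgue_on \<Omega>. norm (\<phi> x) \<le> M"
      using Cc1_bounded[OF \<phi> \<Omega>(2)] by blast
    have c: "L2fun \<Omega> \<phi>" "L2fun \<Omega> D\<phi>"
      by (intro L2fun_continuous[OF \<Omega>] Cc1_continuous[OF \<phi>])+
    note cm = c[THEN L2fun_measurable]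
    have e1: "L2ip \<Omega> (\<lambda>x. A x *v \<phi> x) w = L2ip \<Omega> A (\<lambda>x. outer (w x) (\<phi> x))" for A
      by (simp add: L2ip_def inner_matrix_vector_outer)
    have e2: "L2ip \<Omega> (\<lambda>x. trace (D\<phi> x) *\<^sub>R u x) w = L2ip \<Omega> u (\<lambda>x. trace (D\<phi> x) *\<^sub>R w x)" for u
      by (simp add: L2ip_def)
    let ?T = "\<lambda>u Gu. L2ip \<Omega> u (\<lambda>x. Gw x *v \<phi> x) + L2ip \<Omega> Gu (\<lambda>x. outer (w x) (\<phi> x))
        + L2ip \<Omega> u (\<lambda>x. trace (D\<phi> x) *\<^sub>R w x)"
    have "(\<lambda>k. ?T (\<psi> k) (D\<psi> k)) \<longlonglongrightarrow> ?T u Gu"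
      by (intro tendsto_add tendsto_L2ip_left a L L2fun_matrix_vector_mult(1)[OF L(6) cm(1) M(2,1)]
          L2fun_outer[OF L(5) cm(1) M(2,1)] L2fun_trace_scaleR(1)[OF c(2) meas(5) wb])
    moreover have "?T (\<psi> k) (D\<psi> k) = 0" for k
      using smooth2[OF \<phi> a(1)[of k]] by (simp add: e1 e2 L2ip_commute[of _ "\<psi> k" "\<lambda>x. Gw x *v \<phi> x"])
    ultimately have "?T u Gu = 0" by (simp add: LIMSEQ_const_iff)
    then show ?thesis by (simp add: e1 e2 L2ip_commute[of _ u "\<lambda>x. Gw x *v \<phi> x"])
  qed
  obtain \<phi> D\<phi> where a_all: "\<forall>k::nat. Cc1 \<Omega> (\<phi> k) (D\<phi> k)"
    "\<forall>k. L2fun \<Omega> (\<phi> k)" "\<forall>k. L2fun \<Omega> (D\<phi> k)"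
    "(\<lambda>k. L2norm \<Omega> (\<lambda>x. \<phi> k x - v x)) \<longlonglongrightarrow> 0"
    "(\<lambda>k. L2norm \<Omega> (\<lambda>x. D\<phi> k x - Gv x)) \<longlonglongrightarrow> 0"
    using H10_grad_approx[OF \<Omega> v] by blast
  note a = a_all[rule_format]
  have e1: "L2ip \<Omega> (\<lambda>x. A x *v v x) p = L2ip \<Omega> v (\<lambda>x. transpose (A x) *v p x)" for A v and p :: "pt \<Rightarrow> real^2"
    by (simp add: L2ip_def dot_lmul_matrix flip: vector_transpose_matrix)
  have e2: "L2ip \<Omega> (\<lambda>x. trace (A x) *\<^sub>R u x) w = L2ip \<Omega> A (\<lambda>x. (u x \<bullet> w x) *\<^sub>R mat 1)" for A :: "pt \<Rightarrow> real^2^2"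
    by (simp add: L2ip_def inner_scaleR_mat_1 mult.commute del: inner_scaleR_right)
  have uw: "L2fun \<Omega> (\<lambda>x. (u x \<bullet> w x) *\<^sub>R (mat 1 :: real^2^2))"
  proof (rule L2fun_mult_bounded(1)[OF L(3) meas(5) wb(1), where c = "norm (mat 1 :: real^2^2)"])
    show "norm ((u x \<bullet> w x) *\<^sub>R (mat 1 :: real^2^2)) \<le> norm (mat 1 :: real^2^2) * norm (w x) * norm (u x)" for x
      using mult_right_mono[OF Cauchy_Schwarz_ineq2[of "u x" "w x"], of "norm (mat 1 :: real^2^2)"]
      by (simp add: mult_ac)
    show "(\<lambda>x. (u x \<bullet> w x) *\<^sub>R (mat 1 :: real^2^2)) \<in> borel_measurable (lebesgue_on \<Omega>)"
      using meas by measurable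
  qed (use wb in auto)
  let ?T = "\<lambda>v Gv. L2ip \<Omega> v (\<lambda>x. transpose (Gw x) *v u x) + L2ip \<Omega> v (\<lambda>x. transpose (Gu x) *v w x)
        + L2ip \<Omega> Gv (\<lambda>x. (u x \<bullet> w x) *\<^sub>R mat 1)"
  have "(\<lambda>k. ?T (\<phi> k) (D\<phi> k)) \<longlonglongrightarrow> ?T v Gv"
    by (intro tendsto_add tendsto_L2ip_left a L uw
        L2fun_matrix_vector_mult(1)[OF L2fun_transpose[OF L(6)] meas(3) ub]
        L2fun_matrix_vector_mult(1)[OF L2fun_transpose[OF L(4)] meas(5) wb])
  moreover have "?T (\<phi> k) (D\<phi> k) = 0" for k
    using smooth1[OF a(1)[of k]] unfolding e1 e2 .
  ultimately have "?T v Gv = 0" by (simp add: LIMSEQ_const_iff)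
  then show ?thesis unfolding e1 e2 .
qed

lemma bstar_self_le:
  assumes \<Omega>: "open \<Omega>" "bounded \<Omega>"
    and v: "v \<in> H10 \<Omega>" and u: "u \<in> H10 \<Omega>"
    and vb: "AE x in lebesgue_on \<Omega>. norm (v x) \<le> Mv" "0 \<le> Mv"
    and ub: "AE x in lebesgue_on \<Omega>. norm (u x) \<le> Mu" "0 \<le> Mu"
  shows "\<bar>bstar \<Omega> v v u\<bar> \<le> (Mv * gradnorm \<Omega> u + Mu * gradnorm \<Omega> v) * L2norm \<Omega> (\<lambda>x. u x - v x)"
proof -
  define w where "w = (\<lambda>x. u x - v x)"
  define Gw where "Gw = (\<lambda>x. grad \<Omega> u x - grad \<Omega> v x)"
  note Hv = H10_grad_grad[OF v] and Hu = H10_grad_grad[OF u]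
  have Hw: "H10_grad \<Omega> w Gw"
    unfolding w_def Gw_def by (rule H10_grad_diff[OF \<Omega> Hu Hv])
  note L = H10_grad_L2fun[OF Hv] H10_grad_L2fun[OF Hu] H10_grad_L2fun[OF Hw]
  note meas = L[THEN L2fun_measurable]
  have wb: "AE x in lebesgue_on \<Omega>. norm (w x) \<le> Mu + Mv"
    using ub(1) vb(1)
  proof eventually_elim
    case (elim x)
    then show ?case using norm_triangle_ineq4[of "u x" "v x"] by (simp add: w_def)
  qed
  note GuL = L2fun_matrix_vector_mult[OF L(4) meas(1) vb]
  note GvL = L2fun_matrix_vector_mult[OF L(2) meas(1) vb]
  note trL = L2fun_trace_scaleR[OF L(2) meas(3) ub]
  have ibp: "L2ip \<Omega> (\<lambda>x. Gw x *v v x) u + L2ip \<Omega> (\<lambda>x. grad \<Omega> u x *v v x) w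
    + L2ip \<Omega> (\<lambda>x. trace (grad \<Omega> v x) *\<^sub>R u x) w = 0"
    using H10_integration_by_parts[OF \<Omega> Hv Hu Hw ub wb] ub vb by simp
  have 1: "L2ip \<Omega> (\<lambda>x. Gw x *v v x) u = L2ip \<Omega> (\<lambda>x. grad \<Omega> u x *v v x) u - L2ip \<Omega> (\<lambda>x. grad \<Omega> v x *v v x) u"
    unfolding Gw_def matrix_vector_mult_diff_rdistrib by (rule L2ip_diff_left[OF GuL(1) GvL(1) L(3)])
  have 2: "L2ip \<Omega> (\<lambda>x. grad \<Omega> u x *v v x) w = L2ip \<Omega> (\<lambda>x. grad \<Omega> u x *v v x) u - L2ip \<Omega> (\<lambda>x. grad \<Omega> u x *v v x) v"
    unfolding w_def by (rule L2ip_diff_right[OF L(3) L(1) GuL(1)])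
  have "bstar \<Omega> v v u = L2ip \<Omega> (\<lambda>x. grad \<Omega> u x *v v x) w + 1/2 * L2ip \<Omega> (\<lambda>x. trace (grad \<Omega> v x) *\<^sub>R u x) w"
    unfolding bstar_def using ibp 1 2 by (simp add: field_simps)
  also have "\<bar>\<dots>\<bar> \<le> Mv * gradnorm \<Omega> u * L2norm \<Omega> w + 1/2 * (2 * Mu * gradnorm \<Omega> v * L2norm \<Omega> w)"
  proof -
    have "\<bar>L2ip \<Omega> (\<lambda>x. grad \<Omega> u x *v v x) w\<bar> \<le> Mv * gradnorm \<Omega> u * L2norm \<Omega> w"
      using L2ip_Cauchy_Schwarz[OF GuL(1) L(5)] mult_right_mono[OF GuL(2) L2norm_nonneg[of \<Omega> w]]
      by (simp add: gradnorm_def)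
    moreover have "\<bar>L2ip \<Omega> (\<lambda>x. trace (grad \<Omega> v x) *\<^sub>R u x) w\<bar> \<le> 2 * Mu * gradnorm \<Omega> v * L2norm \<Omega> w"
      using L2ip_Cauchy_Schwarz[OF trL(1) L(5)] mult_right_mono[OF trL(2) L2norm_nonneg[of \<Omega> w]]
      by (simp add: gradnorm_def)
    ultimately show ?thesis by linarith
  qed
  finally show ?thesis by (simp add: w_def algebra_simps)
qed

section \<open>The energy estimate\<close>

lemma L2norm_add_scaleR_power2_le:
  assumes "L2fun \<Omega> a" "L2fun \<Omega> b"
  shows "(L2norm \<Omega> (\<lambda>x. a x + c *\<^sub>R b x))\<^sup>2 \<le> (1 + c\<^sup>2) * ((L2norm \<Omega> a)\<^sup>2 + (L2norm \<Omega> b)\<^sup>2)"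
proof -
  let ?A = "L2norm \<Omega> a" and ?B = "L2norm \<Omega> b"
  have "(L2norm \<Omega> (\<lambda>x. a x + c *\<^sub>R b x))\<^sup>2 \<le> (?A + \<bar>c\<bar> * ?B)\<^sup>2"
    using L2norm_triangle[OF assms(1) L2fun_cmult[OF assms(2), of c]]
    by (intro power_mono) (auto simp: L2norm_cmult L2norm_nonneg)
  also have "\<dots> \<le> (1 + c\<^sup>2) * (?A\<^sup>2 + ?B\<^sup>2)"
    using zero_le_power2[of "\<bar>c\<bar> * ?A - ?B"] by (simp add: power2_eq_square algebra_simps)
  finally show ?thesis .
qed

text \<open>\<^term>\<open>A\<close> and \<^term>\<open>B\<close> are the squared norms of the increments $a = u^{n+1} - u^n$ and
  $b = u^n - u^{n-1}$. One half of $\frac14 (A + B)$ pays for $a + \omega b$ in the estimate, the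
  other for $W = \|a - \omega b\|$, which comes from the nonlinear term.\<close>

lemma energy_step_arith:
  fixes k \<nu> c l \<omega> :: real
  assumes pos: "0 < k" "0 < \<nu>" "0 \<le> c" "0 \<le> l" "0 \<le> e" "0 \<le> g" "0 \<le> W"
    and momentum: "(U1 - U0 + A) / 2 + k * \<nu> * g\<^sup>2 + k * bst = k * fu"
    and bst: "\<bar>bst\<bar> \<le> 2 * c * sqrt l * e * g * W"
    and fu: "fu \<le> d * g"
    and W: "W\<^sup>2 \<le> (1 + \<omega>\<^sup>2) * (A + B)" and P: "P \<le> (1 + \<omega>\<^sup>2) * (A + B)"
    and cfl: "16 * c\<^sup>2 * k * (1 + \<omega>\<^sup>2) * l / \<nu> * e\<^sup>2 \<le> 1"
  shows "(1/2 * U1 + 1/4 * A) + (\<nu>/4 * (k * g\<^sup>2) + 1 / (8 * (1 + \<omega>\<^sup>2)) * P)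
    \<le> k / \<nu> * d\<^sup>2 + (1/2 * U0 + 1/4 * B)"
proof -
  define s where "s = 1 + \<omega>\<^sup>2"
  have s: "0 < s" by (simp add: s_def add_pos_nonneg)
  define Y where "Y = k * c * sqrt l * e * g"
  have P': "1 / (8 * s) * P \<le> (A + B) / 8" and W': "W\<^sup>2 / (8 * s) \<le> (A + B) / 8"
    using P W s by (simp_all add: field_simps flip: s_def)
  have "2 * Y * W \<le> W\<^sup>2 / (8 * s) + 8 * s * Y\<^sup>2"
  proof -
    have "0 \<le> (W - 8 * s * Y)\<^sup>2 / (8 * s)" using s by simp
    then show ?thesis using s by (simp add: field_simps power2_eq_square)
  qed
  moreover have "8 * s * Y\<^sup>2 \<le> k * \<nu> * g\<^sup>2 / 2"
  proof -
    have "8 * s * Y\<^sup>2 = (k * \<nu> * g\<^sup>2 / 2) * (16 * c\<^sup>2 * k * s * l / \<nu> * e\<^sup>2)"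
      using pos by (simp add: Y_def power_mult_distrib) (simp add: power2_eq_square)
    also have "\<dots> \<le> (k * \<nu> * g\<^sup>2 / 2) * 1"
      using cfl pos by (intro mult_left_mono) (simp_all flip: s_def)
    finally show ?thesis by simp
  qed
  moreover have "k * \<bar>bst\<bar> \<le> 2 * Y * W"
    using mult_left_mono[OF bst, of k] pos by (simp add: Y_def mult_ac)
  moreover have "- (k * bst) \<le> k * \<bar>bst\<bar>"
    using mult_left_mono[of "- bst" "\<bar>bst\<bar>" k] pos by simp
  moreover have "k * fu \<le> k / \<nu> * d\<^sup>2 + k * \<nu> * g\<^sup>2 / 4"
  proof -
    have "k * fu \<le> k * (d * g)"
      using fu pos by simp
    also have "\<dots> \<le> k / \<nu> * d\<^sup>2 + k * \<nu> * g\<^sup>2 / 4"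
    proof -
      have "0 \<le> k / \<nu> * (d - \<nu> * g / 2)\<^sup>2" using pos by simp
      then show ?thesis using pos by (simp add: field_simps power2_eq_square)
    qed
    finally show ?thesis .
  qed
  moreover have "\<nu>/4 * (k * g\<^sup>2) = k * \<nu> * g\<^sup>2 / 4"
    by simp
  ultimately show ?thesis
    using momentum P' W' unfolding s_def[symmetric] by argo
qed

lemma sum_telescope_le:
  fixes S D F :: "nat \<Rightarrow> real"
  assumes "\<And>n. n \<in> {1..m} \<Longrightarrow> S (n + 1) + D n \<le> F n + S n"
  shows "S (m + 1) + (\<Sum>n=1..m. D n) \<le> (\<Sum>n=1..m. F n) + S 1"
  using assms
proof (induction m)
  case (Suc m)
  have "S (m + 1) + (\<Sum>n=1..m. D n) \<le> (\<Sum>n=1..m. F n) + S 1"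
    using Suc.prems by (intro Suc.IH) auto
  moreover have "S (Suc m + 1) + D (Suc m) \<le> F (Suc m) + S (Suc m)"
    using Suc.prems[of "Suc m"] by simp
  ultimately show ?case by simp
qed simp

lemma VSS_BE_AB2_energy_step:
  assumes \<Omega>: "open \<Omega>" "bounded \<Omega>" and Cinv: "0 < Cinv"
    and fe: "fe_spaces \<Omega> Cinv h Xh Qh" and \<nu>: "0 < \<nu>"
    and t: "\<forall>n<N. t n < t (Suc n)" and f: "\<forall>n\<in>{2..N}. L2fun \<Omega> (f n)"
    and scheme: "VSS_BE_AB2 \<Omega> Xh Qh \<nu> t N f u p" and n: "n \<in> {1..N-1}"
    and cfl: "1 - 16 * Cinv\<^sup>2 * dt t n * (1 + (omega t n)^2) * \<bar>ln h\<bar> / \<nu> * (gradnorm \<Omega> (Eext t u n))^2 \<ge> 0"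
  shows "(1/2 * (L2norm \<Omega> (u (n+1)))\<^sup>2 + 1/4 * (L2norm \<Omega> (\<lambda>x. u (n+1) x - u n x))\<^sup>2)
      + (\<nu>/4 * (dt t n * (gradnorm \<Omega> (u (n+1)))\<^sup>2)
         + 1 / (8 * (1 + (omega t n)\<^sup>2)) *
            (L2norm \<Omega> (\<lambda>x. u (n+1) x - u n x + omega t n *\<^sub>R (u n x - u (n-1) x)))\<^sup>2)
    \<le> dt t n / \<nu> * (dualnorm \<Omega> (f (n+1)))\<^sup>2
      + (1/2 * (L2norm \<Omega> (u n))\<^sup>2 + 1/4 * (L2norm \<Omega> (\<lambda>x. u n x - u (n-1) x))\<^sup>2)"
proof -
  let ?k = "dt t n" and ?w = "omega t n" and ?E = "Eext t u n"
  have XhH: "Xh \<subseteq> H10 \<Omega>" and lin: "lin_subspace Xh"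
    and bound: "\<And>v. v \<in> Xh \<Longrightarrow> AE x in lebesgue_on \<Omega>. norm (v x) \<le> Cinv * sqrt \<bar>ln h\<bar> * gradnorm \<Omega> v"
    using fe by (auto simp: fe_spaces_def)
  have uX: "u (n+1) \<in> Xh" "u n \<in> Xh" "u (n-1) \<in> Xh" and pQ: "p (n+1) \<in> Qh"
    and eq: "\<And>v. v \<in> Xh \<Longrightarrow> L2ip \<Omega> (\<lambda>x. (1 / dt t n) *\<^sub>R (u (n+1) x - u n x)) v
           + \<nu> * L2ip \<Omega> (grad \<Omega> (u (n+1))) (grad \<Omega> v)
           + bstar \<Omega> (Eext t u n) (Eext t u n) v
           - L2ip \<Omega> (p (n+1)) (divg \<Omega> v)
           = L2ip \<Omega> (f (n+1)) v"
    and div: "\<And>q. q \<in> Qh \<Longrightarrow> L2ip \<Omega> (divg \<Omega> (u (n+1))) q = 0"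
    using scheme n unfolding VSS_BE_AB2_def by auto
  have EX: "?E \<in> Xh"
  proof -
    have add: "\<And>a b. a \<in> Xh \<Longrightarrow> b \<in> Xh \<Longrightarrow> (\<lambda>x. a x + b x) \<in> Xh"
      and scale: "\<And>a c. a \<in> Xh \<Longrightarrow> (\<lambda>x. c *\<^sub>R a x) \<in> Xh"
      using lin unfolding lin_subspace_def by blast+
    have "(\<lambda>x. (1 + ?w) *\<^sub>R u n x + (- ?w) *\<^sub>R u (n-1) x) \<in> Xh"
      by (intro add scale uX)
    then show ?thesis by (simp add: Eext_def)
  qed
  have L: "L2fun \<Omega> v" if "v \<in> Xh" for v
    using that XhH H10_grad_L2fun(1) H10_grad_grad by blast
  note LD = L2fun_diff[OF L[OF uX(1)] L[OF uX(2)]] L2fun_diff[OF L[OF uX(2)] L[OF uX(3)]]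
  have k: "0 < ?k" using t n by (auto simp: dt_def)
  have g0: "0 \<le> gradnorm \<Omega> v" for v by (simp add: gradnorm_def L2norm_nonneg)
  have arith: "Z / 2 + k * \<nu> * G + k * b = k * F" if "2 * X * k = Z" "X + \<nu> * G + b = F" for k X Z G b F :: real
    using that by (auto simp: algebra_simps)
  show ?thesis
  proof (rule energy_step_arith[where bst = "bstar \<Omega> ?E ?E (u (n+1))" and c = Cinv and l = "\<bar>ln h\<bar>"
        and e = "gradnorm \<Omega> ?E" and W = "L2norm \<Omega> (\<lambda>x. u (n+1) x - ?E x)" and fu = "L2ip \<Omega> (f (n+1)) (u (n+1))"])
    have "2 * L2ip \<Omega> (\<lambda>x. (1 / ?k) *\<^sub>R (u (n+1) x - u n x)) (u (n+1)) * ?k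
        = (L2norm \<Omega> (u (n+1)))\<^sup>2 - (L2norm \<Omega> (u n))\<^sup>2 + (L2norm \<Omega> (\<lambda>x. u (n+1) x - u n x))\<^sup>2"
      using k unfolding L2norm_diff_power2[OF L[OF uX(1)] L[OF uX(2)]] L2ip_cmult_left
        L2ip_diff_left[OF L[OF uX(1)] L[OF uX(2)] L[OF uX(1)]]
      by (simp add: L2norm_power2 L2ip_commute[of \<Omega> "u n" "u (Suc n)"])
    moreover have "L2ip \<Omega> (\<lambda>x. (1 / ?k) *\<^sub>R (u (n+1) x - u n x)) (u (n+1)) + \<nu> * (gradnorm \<Omega> (u (n+1)))\<^sup>2
        + bstar \<Omega> ?E ?E (u (n+1)) = L2ip \<Omega> (f (n+1)) (u (n+1))"
      using eq[OF uX(1)] div[OF pQ] by (simp add: gradnorm_def L2norm_power2 L2ip_commute[of \<Omega> "p (Suc n)"])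
    ultimately show "((L2norm \<Omega> (u (n+1)))\<^sup>2 - (L2norm \<Omega> (u n))\<^sup>2 + (L2norm \<Omega> (\<lambda>x. u (n+1) x - u n x))\<^sup>2) / 2
        + ?k * \<nu> * (gradnorm \<Omega> (u (n+1)))\<^sup>2 + ?k * bstar \<Omega> ?E ?E (u (n+1)) = ?k * L2ip \<Omega> (f (n+1)) (u (n+1))"
      by (rule arith)
    show "\<bar>bstar \<Omega> ?E ?E (u (n+1))\<bar> \<le> 2 * Cinv * sqrt \<bar>ln h\<bar> * gradnorm \<Omega> ?E * gradnorm \<Omega> (u (n+1))
        * L2norm \<Omega> (\<lambda>x. u (n+1) x - ?E x)"
      using bstar_self_le[OF \<Omega> _ _ bound[OF EX] _ bound[OF uX(1)]] EX uX XhH Cinv g0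
      by (simp add: subset_iff algebra_simps)
    show "L2ip \<Omega> (f (n+1)) (u (n+1)) \<le> dualnorm \<Omega> (f (n+1)) * gradnorm \<Omega> (u (n+1))"
      using f n uX(1) XhH by (intro L2ip_le_dualnorm \<Omega>) auto
    show "(L2norm \<Omega> (\<lambda>x. u (n+1) x - ?E x))\<^sup>2 \<le> (1 + ?w\<^sup>2) * ((L2norm \<Omega> (\<lambda>x. u (n+1) x - u n x))\<^sup>2
        + (L2norm \<Omega> (\<lambda>x. u n x - u (n-1) x))\<^sup>2)"
    proof -
      have "(\<lambda>x. u (n+1) x - ?E x) = (\<lambda>x. (u (n+1) x - u n x) + (- ?w) *\<^sub>R (u n x - u (n-1) x))"
        by (simp add: Eext_def algebra_simps)
      then show ?thesis
        using L2norm_add_scaleR_power2_le[OF LD, of "- ?w"] by simp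
    qed
    show "(L2norm \<Omega> (\<lambda>x. u (n+1) x - u n x + ?w *\<^sub>R (u n x - u (n-1) x)))\<^sup>2
       \<le> (1 + ?w\<^sup>2) * ((L2norm \<Omega> (\<lambda>x. u (n+1) x - u n x))\<^sup>2 + (L2norm \<Omega> (\<lambda>x. u n x - u (n-1) x))\<^sup>2)"
      by (rule L2norm_add_scaleR_power2_le[OF LD])
  qed (use k \<nu> Cinv g0 L2norm_nonneg cfl in auto)
qed

theorem mainTheorem3:
  fixes \<Omega> :: "pt set" and Cinv :: real
  assumes "polygonal_domain \<Omega>" and "Cinv > 0"
  shows "\<exists>Cstab>0. \<forall>h Xh Qh \<nu> t N f u p.
     h > 0 \<and> fe_spaces \<Omega> Cinv h Xh Qh \<and> \<nu> > 0 \<and>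
     t 0 = 0 \<and> (\<forall>n<N. t n < t (Suc n)) \<and> N > 1 \<and>
     (\<forall>n\<in>{2..N}. L2fun \<Omega> (f n)) \<and>
     VSS_BE_AB2 \<Omega> Xh Qh \<nu> t N f u p \<and>
     (\<forall>n\<in>{1..N-1}.
        1 - Cstab * dt t n * (1 + (omega t n)^2) * \<bar>ln h\<bar> / \<nu> * (gradnorm \<Omega> (Eext t u n))^2 \<ge> 0)
     \<longrightarrow>
     1/2 * (L2norm \<Omega> (u N))^2 + 1/4 * (L2norm \<Omega> (\<lambda>x. u N x - u (N-1) x))^2
     + \<nu>/4 * (\<Sum>n=1..N-1. dt t n * (gradnorm \<Omega> (u (n+1)))^2)
     + (\<Sum>n=1..N-1. 1 / (8 * (1 + (omega t n)^2)) *
          (L2norm \<Omega> (\<lambda>x. u (n+1) x - u n x + omega t n *\<^sub>R (u n x - u (n-1) x)))^2)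
     \<le> (\<Sum>n=1..N-1. dt t n / \<nu> * (dualnorm \<Omega> (f (n+1)))^2)
       + 1/2 * (L2norm \<Omega> (u 1))^2 + 1/4 * (L2norm \<Omega> (\<lambda>x. u 1 x - u 0 x))^2"
proof (rule exI[of _ "16 * Cinv\<^sup>2"], intro conjI allI impI, goal_cases)
  case 1
  show ?case using assms(2) by simp
next
  case (2 h Xh Qh \<nu> t N f u p)
  have \<Omega>: "open \<Omega>" "bounded \<Omega>"
    using assms(1) by (auto simp: polygonal_domain_def)
  define S where "S = (\<lambda>n. 1/2 * (L2norm \<Omega> (u n))\<^sup>2 + 1/4 * (L2norm \<Omega> (\<lambda>x. u n x - u (n-1) x))\<^sup>2)"
  define D where "D = (\<lambda>n. \<nu>/4 * (dt t n * (gradnorm \<Omega> (u (n+1)))\<^sup>2)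
         + 1 / (8 * (1 + (omega t n)\<^sup>2)) *
            (L2norm \<Omega> (\<lambda>x. u (n+1) x - u n x + omega t n *\<^sub>R (u n x - u (n-1) x)))\<^sup>2)"
  have "S (n + 1) + D n \<le> dt t n / \<nu> * (dualnorm \<Omega> (f (n+1)))\<^sup>2 + S n" if "n \<in> {1..N-1}" for n
  proof -
    from 2 have *: "fe_spaces \<Omega> Cinv h Xh Qh" "0 < \<nu>" "\<forall>n<N. t n < t (Suc n)" "\<forall>n\<in>{2..N}. L2fun \<Omega> (f n)"
        "VSS_BE_AB2 \<Omega> Xh Qh \<nu> t N f u p"
      and cfl: "1 - 16 * Cinv\<^sup>2 * dt t n * (1 + (omega t n)^2) * \<bar>ln h\<bar> / \<nu> * (gradnorm \<Omega> (Eext t u n))^2 \<ge> 0"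
      using that by blast+
    show ?thesis
      unfolding S_def D_def add_diff_cancel_right' by (rule VSS_BE_AB2_energy_step[OF \<Omega> assms(2) * that cfl])
  qed
  then have "S (N - 1 + 1) + (\<Sum>n=1..N-1. D n) \<le> (\<Sum>n=1..N-1. dt t n / \<nu> * (dualnorm \<Omega> (f (n+1)))\<^sup>2) + S 1"
    by (rule sum_telescope_le)
  moreover have "N - 1 + 1 = N" using 2 by simp
  ultimately show ?case
    unfolding S_def D_def sum.distrib sum_distrib_left by simp
qed

end
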